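(* Let $\mathcal{E}=\mathbf{Set}(T)$ be the classifying topos of a positive existential theory $T$ having disjoint coproducts and eliminating imaginaries. Sub-compact deterministic automata in $\mathcal{E}$ recognize exactly the languages whose Myhill-Nerode quotients are sub-compact; that is, a language $L\colon\Sigma^*\to\Omega$ is recognized by a deterministic automaton whose object of states is sub-compact if and only if the Myhill-Nerode quotient of $L$ is sub-compact.
   Context: An object $X$ of a category with filtered colimits is compact if $\mathrm{hom}(X,-)$ preserves filtered colimits of monomorphisms; an object is sub-compact if it is a subobject of a compact object. $\Omega$ is the subobject classifier; $\Sigma^*$ is the free monoid on $\Sigma$ with $\mathrm{concat}$; a language is a morphism $L\colon\Sigma^*\to\Omega$. A deterministic automaton consists of a state object $S$, initial state $s_0\colon1\to S$, final states $F\rightarrowtail S$ and transition function $\sigma\colon\Sigma\times S\to S$; its language is the pullback of $F$ along the map $\Sigma^*\to S$ sending a word to the state reached from $s_0$ (induced by the monoid homomorphism $\Sigma^*\to S^S$ extending the transpose of $\sigma$). The Myhill-Nerode quotient of $L$ is the coequaliser of the kernel pair of the transpose $(L\circ\mathrm{concat})^\dagger\colon\Sigma^*\to\Omega^{\Sigma^*}$. *)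

theory Defs
  imports "HOL-Library.FuncSet" "HOL-Library.Equipollence"
begin

section \<open>Categories\<close>

record ('o, 'a) category =
  Ob :: "'o set"
  Ar :: "'a set"
  Dom :: "'a \<Rightarrow> 'o"
  Cod :: "'a \<Rightarrow> 'o"
  Id :: "'o \<Rightarrow> 'a"
  Comp :: "'a \<Rightarrow> 'a \<Rightarrow> 'a"  (infixr "\<cdot>\<index>" 75)

definition hom :: "('o, 'a, 'z) category_scheme \<Rightarrow> 'o \<Rightarrow> 'o \<Rightarrow> 'a set" where
  "hom C A B = {f \<in> Ar C. Dom C f = A \<and> Cod C f = B}"

definition is_category :: "('o, 'a, 'z) category_scheme \<Rightarrow> bool" where
  "is_category C \<longleftrightarrow>
     (\<forall>f\<in>Ar C. Dom C f \<in> Ob C \<and> Cod C f \<in> Ob C) \<and>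
     (\<forall>A\<in>Ob C. Id C A \<in> hom C A A) \<and>
     (\<forall>f\<in>Ar C. \<forall>g\<in>Ar C. Dom C g = Cod C f \<longrightarrow> g \<cdot>\<^bsub>C\<^esub> f \<in> hom C (Dom C f) (Cod C g)) \<and>
     (\<forall>f\<in>Ar C. f \<cdot>\<^bsub>C\<^esub> Id C (Dom C f) = f \<and> Id C (Cod C f) \<cdot>\<^bsub>C\<^esub> f = f) \<and>
     (\<forall>f\<in>Ar C. \<forall>g\<in>Ar C. \<forall>h\<in>Ar C. Dom C g = Cod C f \<and> Dom C h = Cod C g \<longrightarrow>
        (h \<cdot>\<^bsub>C\<^esub> g) \<cdot>\<^bsub>C\<^esub> f = h \<cdot>\<^bsub>C\<^esub> (g \<cdot>\<^bsub>C\<^esub> f))"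

definition monic :: "('o, 'a, 'z) category_scheme \<Rightarrow> 'a \<Rightarrow> bool" where
  "monic C m \<longleftrightarrow> m \<in> Ar C \<and>
     (\<forall>X. \<forall>f\<in>hom C X (Dom C m). \<forall>g\<in>hom C X (Dom C m). m \<cdot>\<^bsub>C\<^esub> f = m \<cdot>\<^bsub>C\<^esub> g \<longrightarrow> f = g)"

definition is_terminal :: "('o, 'a, 'z) category_scheme \<Rightarrow> 'o \<Rightarrow> bool" where
  "is_terminal C Z \<longleftrightarrow> Z \<in> Ob C \<and> (\<forall>X\<in>Ob C. \<exists>!f. f \<in> hom C X Z)"

definition is_initial :: "('o, 'a, 'z) category_scheme \<Rightarrow> 'o \<Rightarrow> bool" where
  "is_initial C Z \<longleftrightarrow> Z \<in> Ob C \<and> (\<forall>X\<in>Ob C. \<exists>!f. f \<in> hom C Z X)"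

definition is_product :: "('o, 'a, 'z) category_scheme \<Rightarrow> 'o \<Rightarrow> 'o \<Rightarrow> 'o \<Rightarrow> 'a \<Rightarrow> 'a \<Rightarrow> bool" where
  "is_product C A B P p q \<longleftrightarrow> P \<in> Ob C \<and> p \<in> hom C P A \<and> q \<in> hom C P B \<and>
     (\<forall>X\<in>Ob C. \<forall>f\<in>hom C X A. \<forall>g\<in>hom C X B.
        \<exists>!h. h \<in> hom C X P \<and> p \<cdot>\<^bsub>C\<^esub> h = f \<and> q \<cdot>\<^bsub>C\<^esub> h = g)"

definition is_coproduct :: "('o, 'a, 'z) category_scheme \<Rightarrow> 'o \<Rightarrow> 'o \<Rightarrow> 'o \<Rightarrow> 'a \<Rightarrow> 'a \<Rightarrow> bool" where
  "is_coproduct C A B P i j \<longleftrightarrow> P \<in> Ob C \<and> i \<in> hom C A P \<and> j \<in> hom C B P \<and>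
     (\<forall>X\<in>Ob C. \<forall>f\<in>hom C A X. \<forall>g\<in>hom C B X.
        \<exists>!h. h \<in> hom C P X \<and> h \<cdot>\<^bsub>C\<^esub> i = f \<and> h \<cdot>\<^bsub>C\<^esub> j = g)"

text \<open>The square is \<open>f p = g q\<close>: \<open>p\<close> is opposite to \<open>g\<close> and \<open>q\<close> is opposite to \<open>f\<close>.\<close>

definition is_pullback :: "('o, 'a, 'z) category_scheme \<Rightarrow> 'a \<Rightarrow> 'a \<Rightarrow> 'a \<Rightarrow> 'a \<Rightarrow> bool" where
  "is_pullback C f g p q \<longleftrightarrow>
     {f, g, p, q} \<subseteq> Ar C \<and> Cod C f = Cod C g \<and> Dom C p = Dom C q \<and>
     Cod C p = Dom C f \<and> Cod C q = Dom C g \<and> f \<cdot>\<^bsub>C\<^esub> p = g \<cdot>\<^bsub>C\<^esub> q \<and>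
     (\<forall>X\<in>Ob C. \<forall>a\<in>hom C X (Dom C f). \<forall>b\<in>hom C X (Dom C g). f \<cdot>\<^bsub>C\<^esub> a = g \<cdot>\<^bsub>C\<^esub> b \<longrightarrow>
        (\<exists>!h. h \<in> hom C X (Dom C p) \<and> p \<cdot>\<^bsub>C\<^esub> h = a \<and> q \<cdot>\<^bsub>C\<^esub> h = b))"

definition is_kernel_pair :: "('o, 'a, 'z) category_scheme \<Rightarrow> 'a \<Rightarrow> 'a \<Rightarrow> 'a \<Rightarrow> bool" where
  "is_kernel_pair C f p q \<longleftrightarrow> is_pullback C f f p q"

definition is_coequaliser :: "('o, 'a, 'z) category_scheme \<Rightarrow> 'a \<Rightarrow> 'a \<Rightarrow> 'a \<Rightarrow> bool" where
  "is_coequaliser C f g e \<longleftrightarrow>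
     {f, g, e} \<subseteq> Ar C \<and> Dom C f = Dom C g \<and> Cod C f = Cod C g \<and> Dom C e = Cod C f \<and>
     e \<cdot>\<^bsub>C\<^esub> f = e \<cdot>\<^bsub>C\<^esub> g \<and>
     (\<forall>X\<in>Ob C. \<forall>k\<in>hom C (Cod C f) X. k \<cdot>\<^bsub>C\<^esub> f = k \<cdot>\<^bsub>C\<^esub> g \<longrightarrow>
        (\<exists>!h. h \<in> hom C (Cod C e) X \<and> h \<cdot>\<^bsub>C\<^esub> e = k))"

definition has_disjoint_coproducts :: "('o, 'a, 'z) category_scheme \<Rightarrow> bool" where
  "has_disjoint_coproducts C \<longleftrightarrow>
     (\<exists>Z. is_initial C Z) \<and>
     (\<forall>A\<in>Ob C. \<forall>B\<in>Ob C. \<exists>P i j p q. is_coproduct C A B P i j \<and> monic C i \<and> monic C j \<and>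
        is_pullback C i j p q \<and> is_initial C (Dom C p))"


section \<open>Small sets\<close>

text \<open>The cardinality of the type \<open>'v\<close> plays the role of a strongly inaccessible cardinal
  \<open>\<kappa>\<close>; sets of smaller cardinality, of whatever element type, are the small sets.
  Up to equivalence, the small subsets of \<open>'v\<close> form the category of sets of the Grothendieck
  universe \<open>V\<^sub>\<kappa>\<close>.\<close>

definition small :: "'v itself \<Rightarrow> 'b set \<Rightarrow> bool" where
  "small V A \<longleftrightarrow> A \<prec> (UNIV :: 'v set)"

definition inaccessible :: "'v itself \<Rightarrow> bool" where
  "inaccessible V \<longleftrightarrow>
     (\<exists>A :: 'v set. infinite A \<and> small V A) \<and>
     (\<forall>A :: 'v set. small V A \<longrightarrow> small V (Pow A)) \<and>
     (\<forall>(I :: 'v set) (A :: 'v \<Rightarrow> 'v set). small V I \<and> (\<forall>i\<in>I. small V (A i)) \<longrightarrow> small V (\<Union>i\<in>I. A i))"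


section \<open>Filtered colimits and compactness\<close>

definition is_functor ::
  "('i, 'j, 'y) category_scheme \<Rightarrow> ('o, 'a, 'z) category_scheme \<Rightarrow> ('i \<Rightarrow> 'o) \<Rightarrow> ('j \<Rightarrow> 'a) \<Rightarrow> bool" where
  "is_functor J C D d \<longleftrightarrow>
     (\<forall>i\<in>Ob J. D i \<in> Ob C \<and> d (Id J i) = Id C (D i)) \<and>
     (\<forall>u\<in>Ar J. d u \<in> hom C (D (Dom J u)) (D (Cod J u))) \<and>
     (\<forall>u\<in>Ar J. \<forall>v\<in>Ar J. Dom J v = Cod J u \<longrightarrow> d (v \<cdot>\<^bsub>J\<^esub> u) = d v \<cdot>\<^bsub>C\<^esub> d u)"

definition is_cocone ::
  "('i, 'j, 'y) category_scheme \<Rightarrow> ('o, 'a, 'z) category_scheme \<Rightarrow> ('i \<Rightarrow> 'o) \<Rightarrow> ('j \<Rightarrow> 'a) \<Rightarrow>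
   'o \<Rightarrow> ('i \<Rightarrow> 'a) \<Rightarrow> bool" where
  "is_cocone J C D d Z z \<longleftrightarrow> Z \<in> Ob C \<and> (\<forall>i\<in>Ob J. z i \<in> hom C (D i) Z) \<and>
     (\<forall>u\<in>Ar J. z (Cod J u) \<cdot>\<^bsub>C\<^esub> d u = z (Dom J u))"

definition is_colimit ::
  "('i, 'j, 'y) category_scheme \<Rightarrow> ('o, 'a, 'z) category_scheme \<Rightarrow> ('i \<Rightarrow> 'o) \<Rightarrow> ('j \<Rightarrow> 'a) \<Rightarrow>
   'o \<Rightarrow> ('i \<Rightarrow> 'a) \<Rightarrow> bool" where
  "is_colimit J C D d Z z \<longleftrightarrow> is_cocone J C D d Z z \<and>
     (\<forall>Y y. is_cocone J C D d Y y \<longrightarrow>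
        (\<exists>!h. h \<in> hom C Z Y \<and> (\<forall>i\<in>Ob J. h \<cdot>\<^bsub>C\<^esub> z i = y i)))"

definition is_filtered :: "('i, 'j, 'y) category_scheme \<Rightarrow> bool" where
  "is_filtered J \<longleftrightarrow> Ob J \<noteq> {} \<and>
     (\<forall>i\<in>Ob J. \<forall>j\<in>Ob J. \<exists>k\<in>Ob J. hom J i k \<noteq> {} \<and> hom J j k \<noteq> {}) \<and>
     (\<forall>u\<in>Ar J. \<forall>v\<in>Ar J. Dom J u = Dom J v \<and> Cod J u = Cod J v \<longrightarrow>
        (\<exists>w\<in>Ar J. Dom J w = Cod J u \<and> w \<cdot>\<^bsub>J\<^esub> u = w \<cdot>\<^bsub>J\<^esub> v))"

definition set_category :: "('b set, 'b set \<times> ('b \<Rightarrow> 'b) \<times> 'b set) category" where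
  "set_category = \<lparr>Ob = UNIV,
     Ar = {(A, f, B). f \<in> A \<rightarrow>\<^sub>E B},
     Dom = (\<lambda>(A, f, B). A),
     Cod = (\<lambda>(A, f, B). B),
     Id = (\<lambda>A. (A, \<lambda>x\<in>A. x, A)),
     Comp = (\<lambda>(B', g, D) (A, f, B). (A, compose A g f, D))\<rparr>"

definition hom_map :: "('o, 'a, 'z) category_scheme \<Rightarrow> 'o \<Rightarrow> 'a \<Rightarrow> 'a set \<times> ('a \<Rightarrow> 'a) \<times> 'a set" where
  "hom_map C X f = (hom C X (Dom C f), \<lambda>g\<in>hom C X (Dom C f). f \<cdot>\<^bsub>C\<^esub> g, hom C X (Cod C f))"

text \<open>Every small category is isomorphic to one whose objects and arrows lie in \<open>'v\<close>, so the
  quantification over \<open>J\<close> ranges over all small filtered categories. The hom-sets of \<open>C\<close> are sets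
  of arrows, so \<open>hom(X,-)\<close> takes values in sets of elements of type \<open>'a\<close>.\<close>

definition compact :: "'v itself \<Rightarrow> ('o, 'a, 'z) category_scheme \<Rightarrow> 'o \<Rightarrow> bool" where
  "compact V C X \<longleftrightarrow> X \<in> Ob C \<and>
     (\<forall>(J :: ('v, 'v) category) D d Z z.
        is_category J \<and> small V (Ob J) \<and> small V (Ar J) \<and> is_filtered J \<and>
        is_functor J C D d \<and> (\<forall>u\<in>Ar J. monic C (d u)) \<and> is_colimit J C D d Z z \<longrightarrow>
        is_colimit J set_category (\<lambda>i. hom C X (D i)) (\<lambda>u. hom_map C X (d u))
          (hom C X Z) (\<lambda>i. hom_map C X (z i)))"

definition sub_compact :: "'v itself \<Rightarrow> ('o, 'a, 'z) category_scheme \<Rightarrow> 'o \<Rightarrow> bool" where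
  "sub_compact V C X \<longleftrightarrow> (\<exists>m. monic C m \<and> Dom C m = X \<and> compact V C (Cod C m))"


section \<open>Elementary toposes with chosen structure\<close>

text \<open>\<open>Exp A B\<close> is the exponential \<open>B\<^sup>A\<close>, with evaluation \<open>Ev A B\<close> from \<open>B\<^sup>A \<times> A\<close> to \<open>B\<close>.\<close>

record ('o, 'a) topos = "('o, 'a) category" +
  One :: 'o
  Prod :: "'o \<Rightarrow> 'o \<Rightarrow> 'o"
  Pr1 :: "'o \<Rightarrow> 'o \<Rightarrow> 'a"
  Pr2 :: "'o \<Rightarrow> 'o \<Rightarrow> 'a"
  Exp :: "'o \<Rightarrow> 'o \<Rightarrow> 'o"
  Ev :: "'o \<Rightarrow> 'o \<Rightarrow> 'a"
  Omega :: 'o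
  Truth :: 'a

definition bang :: "('o, 'a, 'z) topos_scheme \<Rightarrow> 'o \<Rightarrow> 'a" where
  "bang E X = (THE f. f \<in> hom E X (One E))"

definition pair :: "('o, 'a, 'z) topos_scheme \<Rightarrow> 'a \<Rightarrow> 'a \<Rightarrow> 'a" where
  "pair E f g = (let A = Cod E f; B = Cod E g in
     THE h. h \<in> hom E (Dom E f) (Prod E A B) \<and> Pr1 E A B \<cdot>\<^bsub>E\<^esub> h = f \<and> Pr2 E A B \<cdot>\<^bsub>E\<^esub> h = g)"

text \<open>\<open>apply_exp E A B k a\<close> is the generalised element \<open>k(a)\<close> of \<open>B\<close> for generalised elements
  \<open>k\<close> of \<open>B\<^sup>A\<close> and \<open>a\<close> of \<open>A\<close>.\<close>

definition apply_exp :: "('o, 'a, 'z) topos_scheme \<Rightarrow> 'o \<Rightarrow> 'o \<Rightarrow> 'a \<Rightarrow> 'a \<Rightarrow> 'a" where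
  "apply_exp E A B k a = Ev E A B \<cdot>\<^bsub>E\<^esub> pair E k a"

definition is_transpose :: "('o, 'a, 'z) topos_scheme \<Rightarrow> 'o \<Rightarrow> 'o \<Rightarrow> 'o \<Rightarrow> 'a \<Rightarrow> 'a \<Rightarrow> bool" where
  "is_transpose E X A B f h \<longleftrightarrow>
     h \<in> hom E X (Exp E A B) \<and> apply_exp E A B (h \<cdot>\<^bsub>E\<^esub> Pr1 E X A) (Pr2 E X A) = f"

definition transpose :: "('o, 'a, 'z) topos_scheme \<Rightarrow> 'o \<Rightarrow> 'o \<Rightarrow> 'o \<Rightarrow> 'a \<Rightarrow> 'a" where
  "transpose E X A B f = (THE h. is_transpose E X A B f h)"

definition classifies :: "('o, 'a, 'z) topos_scheme \<Rightarrow> 'a \<Rightarrow> 'a \<Rightarrow> bool" where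
  "classifies E c m \<longleftrightarrow> is_pullback E c (Truth E) m (bang E (Dom E m))"

definition elementary_topos :: "('o, 'a, 'z) topos_scheme \<Rightarrow> bool" where
  "elementary_topos E \<longleftrightarrow> is_category E \<and>
     is_terminal E (One E) \<and>
     (\<forall>A\<in>Ob E. \<forall>B\<in>Ob E. is_product E A B (Prod E A B) (Pr1 E A B) (Pr2 E A B)) \<and>
     (\<forall>f\<in>Ar E. \<forall>g\<in>Ar E. Cod E f = Cod E g \<longrightarrow> (\<exists>p q. is_pullback E f g p q)) \<and>
     (\<forall>A\<in>Ob E. \<forall>B\<in>Ob E. Exp E A B \<in> Ob E \<and> Ev E A B \<in> hom E (Prod E (Exp E A B) A) B \<and>
        (\<forall>X\<in>Ob E. \<forall>f\<in>hom E (Prod E X A) B. \<exists>!h. is_transpose E X A B f h)) \<and>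
     Omega E \<in> Ob E \<and> Truth E \<in> hom E (One E) (Omega E) \<and>
     (\<forall>m. monic E m \<longrightarrow> (\<exists>!c. c \<in> hom E (Cod E m) (Omega E) \<and> classifies E c m))"


section \<open>Monoids, languages and automata in a topos\<close>

text \<open>The monoid equations are stated for generalised elements.\<close>

definition is_monoid :: "('o, 'a, 'z) topos_scheme \<Rightarrow> 'o \<Rightarrow> 'a \<Rightarrow> 'a \<Rightarrow> bool" where
  "is_monoid E M m e \<longleftrightarrow> M \<in> Ob E \<and> m \<in> hom E (Prod E M M) M \<and> e \<in> hom E (One E) M \<and>
     (\<forall>X\<in>Ob E. \<forall>x\<in>hom E X M. \<forall>y\<in>hom E X M. \<forall>z\<in>hom E X M.
        m \<cdot>\<^bsub>E\<^esub> pair E (m \<cdot>\<^bsub>E\<^esub> pair E x y) z = m \<cdot>\<^bsub>E\<^esub> pair E x (m \<cdot>\<^bsub>E\<^esub> pair E y z)) \<and>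
     (\<forall>X\<in>Ob E. \<forall>x\<in>hom E X M.
        m \<cdot>\<^bsub>E\<^esub> pair E (e \<cdot>\<^bsub>E\<^esub> bang E X) x = x \<and> m \<cdot>\<^bsub>E\<^esub> pair E x (e \<cdot>\<^bsub>E\<^esub> bang E X) = x)"

definition is_monoid_hom ::
  "('o, 'a, 'z) topos_scheme \<Rightarrow> 'o \<Rightarrow> 'a \<Rightarrow> 'a \<Rightarrow> 'o \<Rightarrow> 'a \<Rightarrow> 'a \<Rightarrow> 'a \<Rightarrow> bool" where
  "is_monoid_hom E M m e N n u h \<longleftrightarrow> h \<in> hom E M N \<and> h \<cdot>\<^bsub>E\<^esub> e = u \<and>
     h \<cdot>\<^bsub>E\<^esub> m = n \<cdot>\<^bsub>E\<^esub> pair E (h \<cdot>\<^bsub>E\<^esub> Pr1 E M M) (h \<cdot>\<^bsub>E\<^esub> Pr2 E M M)"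

definition is_free_monoid ::
  "('o, 'a, 'z) topos_scheme \<Rightarrow> 'o \<Rightarrow> 'o \<Rightarrow> 'a \<Rightarrow> 'a \<Rightarrow> 'a \<Rightarrow> bool" where
  "is_free_monoid E A M m e i \<longleftrightarrow> A \<in> Ob E \<and> is_monoid E M m e \<and> i \<in> hom E A M \<and>
     (\<forall>N n u f. is_monoid E N n u \<and> f \<in> hom E A N \<longrightarrow>
        (\<exists>!h. is_monoid_hom E M m e N n u h \<and> h \<cdot>\<^bsub>E\<^esub> i = f))"

text \<open>Multiplication on \<open>S\<^sup>S\<close> is composition in diagrammatic order, \<open>(f, g) \<mapsto> (s \<mapsto> g(f(s)))\<close>,
  so that an automaton reads words from left to right.\<close>

definition endo_mult :: "('o, 'a, 'z) topos_scheme \<Rightarrow> 'o \<Rightarrow> 'a" where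
  "endo_mult E S = (let K = Exp E S S; KK = Prod E K K;
       f = Pr1 E K K \<cdot>\<^bsub>E\<^esub> Pr1 E KK S; g = Pr2 E K K \<cdot>\<^bsub>E\<^esub> Pr1 E KK S; s = Pr2 E KK S
     in transpose E KK S S (apply_exp E S S g (apply_exp E S S f s)))"

definition endo_unit :: "('o, 'a, 'z) topos_scheme \<Rightarrow> 'o \<Rightarrow> 'a" where
  "endo_unit E S = transpose E (One E) S S (Pr2 E (One E) S)"

record ('o, 'a) automaton =
  States :: 'o
  Start :: 'a
  Final :: 'a
  Step :: 'a

definition deterministic_automaton :: "('o, 'a, 'z) topos_scheme \<Rightarrow> 'o \<Rightarrow> ('o, 'a) automaton \<Rightarrow> bool" where
  "deterministic_automaton E A M \<longleftrightarrow> States M \<in> Ob E \<and>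
     Start M \<in> hom E (One E) (States M) \<and>
     monic E (Final M) \<and> Cod E (Final M) = States M \<and>
     Step M \<in> hom E (Prod E A (States M)) (States M)"

text \<open>Here \<open>W\<close>, with concatenation \<open>w\<close>, empty word \<open>e\<close> and inclusion of letters \<open>i\<close>, is the
  free monoid on the alphabet \<open>A\<close>. The language is given by its characteristic morphism.\<close>

definition is_run ::
  "('o, 'a, 'z) topos_scheme \<Rightarrow> 'o \<Rightarrow> 'o \<Rightarrow> 'a \<Rightarrow> 'a \<Rightarrow> 'a \<Rightarrow> ('o, 'a) automaton \<Rightarrow> 'a \<Rightarrow> bool" where
  "is_run E A W w e i M r \<longleftrightarrow> (let S = States M in
     \<exists>h. is_monoid_hom E W w e (Exp E S S) (endo_mult E S) (endo_unit E S) h \<and>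
         h \<cdot>\<^bsub>E\<^esub> i = transpose E A S S (Step M) \<and>
         r = apply_exp E S S h (Start M \<cdot>\<^bsub>E\<^esub> bang E W))"

definition recognizes ::
  "('o, 'a, 'z) topos_scheme \<Rightarrow> 'o \<Rightarrow> 'o \<Rightarrow> 'a \<Rightarrow> 'a \<Rightarrow> 'a \<Rightarrow> ('o, 'a) automaton \<Rightarrow> 'a \<Rightarrow> bool" where
  "recognizes E A W w e i M L \<longleftrightarrow>
     (\<exists>r p q. is_run E A W w e i M r \<and> is_pullback E r (Final M) p q \<and> classifies E L p)"

definition is_myhill_nerode_quotient ::
  "('o, 'a, 'z) topos_scheme \<Rightarrow> 'o \<Rightarrow> 'a \<Rightarrow> 'a \<Rightarrow> 'o \<Rightarrow> bool" where
  "is_myhill_nerode_quotient E W w L Q \<longleftrightarrow>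
     (\<exists>k l c. is_kernel_pair E (transpose E W W (Omega E) (L \<cdot>\<^bsub>E\<^esub> w)) k l \<and>
        is_coequaliser E k l c \<and> Cod E c = Q)"


section \<open>Positive existential theories\<close>

text \<open>Formulas are in de Bruijn notation. A context is a list of sorts; variable \<open>i\<close> has the
  \<open>i\<close>-th sort of the list, and \<open>Ex s\<close> binds variable \<open>0\<close>.\<close>

datatype 'f trm = Var nat | Fn 'f "'f trm list"

datatype ('s, 'f, 'r) fm =
    Top
  | Bot
  | Eq "'f trm" "'f trm"
  | Rel 'r "'f trm list"
  | Conj "('s, 'f, 'r) fm" "('s, 'f, 'r) fm"
  | Disj "('s, 'f, 'r) fm" "('s, 'f, 'r) fm"
  | Ex 's "('s, 'f, 'r) fm"

primrec tsubst :: "(nat \<Rightarrow> 'f trm) \<Rightarrow> 'f trm \<Rightarrow> 'f trm" where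
  "tsubst \<sigma> (Var i) = \<sigma> i"
| "tsubst \<sigma> (Fn f ts) = Fn f (map (tsubst \<sigma>) ts)"

definition under_binder :: "(nat \<Rightarrow> 'f trm) \<Rightarrow> nat \<Rightarrow> 'f trm" where
  "under_binder \<sigma> = case_nat (Var 0) (\<lambda>i. tsubst (\<lambda>j. Var (Suc j)) (\<sigma> i))"

primrec fsubst :: "(nat \<Rightarrow> 'f trm) \<Rightarrow> ('s, 'f, 'r) fm \<Rightarrow> ('s, 'f, 'r) fm" where
  "fsubst \<sigma> Top = Top"
| "fsubst \<sigma> Bot = Bot"
| "fsubst \<sigma> (Eq t u) = Eq (tsubst \<sigma> t) (tsubst \<sigma> u)"
| "fsubst \<sigma> (Rel R ts) = Rel R (map (tsubst \<sigma>) ts)"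
| "fsubst \<sigma> (Conj \<phi> \<psi>) = Conj (fsubst \<sigma> \<phi>) (fsubst \<sigma> \<psi>)"
| "fsubst \<sigma> (Disj \<phi> \<psi>) = Disj (fsubst \<sigma> \<phi>) (fsubst \<sigma> \<psi>)"
| "fsubst \<sigma> (Ex s \<phi>) = Ex s (fsubst (under_binder \<sigma>) \<phi>)"

definition rename :: "(nat \<Rightarrow> nat) \<Rightarrow> ('s, 'f, 'r) fm \<Rightarrow> ('s, 'f, 'r) fm" where
  "rename \<rho> = fsubst (\<lambda>i. Var (\<rho> i))"

definition inst :: "'f trm \<Rightarrow> ('s, 'f, 'r) fm \<Rightarrow> ('s, 'f, 'r) fm" where
  "inst t = fsubst (case_nat t Var)"

text \<open>An axiom \<open>(\<Gamma>, \<phi>, \<psi>)\<close> is the sequent \<open>\<phi> \<turnstile>\<^sub>\<Gamma> \<psi>\<close>, that is \<open>\<forall>\<Gamma>. \<phi> \<longrightarrow> \<psi>\<close>.\<close>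

record ('s, 'f, 'r) pe_theory =
  Sorts :: "'s set"
  Funs :: "'f set"
  Rels :: "'r set"
  Fun_dom :: "'f \<Rightarrow> 's list"
  Fun_cod :: "'f \<Rightarrow> 's"
  Rel_dom :: "'r \<Rightarrow> 's list"
  Axioms :: "('s list \<times> ('s, 'f, 'r) fm \<times> ('s, 'f, 'r) fm) set"

definition is_context :: "('s, 'f, 'r) pe_theory \<Rightarrow> 's list \<Rightarrow> bool" where
  "is_context T \<Gamma> \<longleftrightarrow> set \<Gamma> \<subseteq> Sorts T"

inductive has_sort :: "('s, 'f, 'r) pe_theory \<Rightarrow> 's list \<Rightarrow> 'f trm \<Rightarrow> 's \<Rightarrow> bool"
  for T :: "('s, 'f, 'r) pe_theory" and \<Gamma> :: "'s list" where
  var: "i < length \<Gamma> \<Longrightarrow> has_sort T \<Gamma> (Var i) (\<Gamma> ! i)"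
| fn: "\<lbrakk>f \<in> Funs T; length ts = length (Fun_dom T f);
        \<And>i. i < length ts \<Longrightarrow> has_sort T \<Gamma> (ts ! i) (Fun_dom T f ! i)\<rbrakk>
       \<Longrightarrow> has_sort T \<Gamma> (Fn f ts) (Fun_cod T f)"

primrec wf_fm :: "('s, 'f, 'r) pe_theory \<Rightarrow> 's list \<Rightarrow> ('s, 'f, 'r) fm \<Rightarrow> bool" where
  "wf_fm T \<Gamma> Top = True"
| "wf_fm T \<Gamma> Bot = True"
| "wf_fm T \<Gamma> (Eq t u) = (\<exists>s\<in>Sorts T. has_sort T \<Gamma> t s \<and> has_sort T \<Gamma> u s)"
| "wf_fm T \<Gamma> (Rel R ts) = (R \<in> Rels T \<and> list_all2 (has_sort T \<Gamma>) ts (Rel_dom T R))"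
| "wf_fm T \<Gamma> (Conj \<phi> \<psi>) = (wf_fm T \<Gamma> \<phi> \<and> wf_fm T \<Gamma> \<psi>)"
| "wf_fm T \<Gamma> (Disj \<phi> \<psi>) = (wf_fm T \<Gamma> \<phi> \<and> wf_fm T \<Gamma> \<psi>)"
| "wf_fm T \<Gamma> (Ex s \<phi>) = (s \<in> Sorts T \<and> wf_fm T (s # \<Gamma>) \<phi>)"

definition positive_existential_theory :: "('s, 'f, 'r) pe_theory \<Rightarrow> bool" where
  "positive_existential_theory T \<longleftrightarrow>
     (\<forall>f\<in>Funs T. is_context T (Fun_dom T f) \<and> Fun_cod T f \<in> Sorts T) \<and>
     (\<forall>R\<in>Rels T. is_context T (Rel_dom T R)) \<and>
     (\<forall>(\<Gamma>, \<phi>, \<psi>)\<in>Axioms T. is_context T \<Gamma> \<and> wf_fm T \<Gamma> \<phi> \<and> wf_fm T \<Gamma> \<psi>)"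

text \<open>The sequent calculus of coherent logic (Johnstone, \<^emph>\<open>Sketches of an Elephant\<close>, D1.3).
  Sorts may be empty, so the context is part of the sequent.\<close>

inductive prov ::
  "('s, 'f, 'r) pe_theory \<Rightarrow> 's list \<Rightarrow> ('s, 'f, 'r) fm \<Rightarrow> ('s, 'f, 'r) fm \<Rightarrow> bool"
  for T :: "('s, 'f, 'r) pe_theory" where
  ax: "(\<Gamma>, \<phi>, \<psi>) \<in> Axioms T \<Longrightarrow> prov T \<Gamma> \<phi> \<psi>"
| refl: "\<lbrakk>is_context T \<Gamma>; wf_fm T \<Gamma> \<phi>\<rbrakk> \<Longrightarrow> prov T \<Gamma> \<phi> \<phi>"
| subst: "\<lbrakk>prov T \<Gamma> \<phi> \<psi>; is_context T \<Delta>; \<And>i. i < length \<Gamma> \<Longrightarrow> has_sort T \<Delta> (\<sigma> i) (\<Gamma> ! i)\<rbrakk>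
          \<Longrightarrow> prov T \<Delta> (fsubst \<sigma> \<phi>) (fsubst \<sigma> \<psi>)"
| cut: "\<lbrakk>prov T \<Gamma> \<phi> \<psi>; prov T \<Gamma> \<psi> \<chi>\<rbrakk> \<Longrightarrow> prov T \<Gamma> \<phi> \<chi>"
| eq_refl: "\<lbrakk>is_context T \<Gamma>; has_sort T \<Gamma> t s\<rbrakk> \<Longrightarrow> prov T \<Gamma> Top (Eq t t)"
| eq_subst: "\<lbrakk>is_context T \<Gamma>; has_sort T \<Gamma> t s; has_sort T \<Gamma> u s; wf_fm T (s # \<Gamma>) \<phi>\<rbrakk>
          \<Longrightarrow> prov T \<Gamma> (Conj (Eq t u) (inst t \<phi>)) (inst u \<phi>)"
| top: "\<lbrakk>is_context T \<Gamma>; wf_fm T \<Gamma> \<phi>\<rbrakk> \<Longrightarrow> prov T \<Gamma> \<phi> Top"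
| conjE1: "\<lbrakk>is_context T \<Gamma>; wf_fm T \<Gamma> \<phi>; wf_fm T \<Gamma> \<psi>\<rbrakk> \<Longrightarrow> prov T \<Gamma> (Conj \<phi> \<psi>) \<phi>"
| conjE2: "\<lbrakk>is_context T \<Gamma>; wf_fm T \<Gamma> \<phi>; wf_fm T \<Gamma> \<psi>\<rbrakk> \<Longrightarrow> prov T \<Gamma> (Conj \<phi> \<psi>) \<psi>"
| conjI: "\<lbrakk>prov T \<Gamma> \<phi> \<psi>; prov T \<Gamma> \<phi> \<chi>\<rbrakk> \<Longrightarrow> prov T \<Gamma> \<phi> (Conj \<psi> \<chi>)"
| bot: "\<lbrakk>is_context T \<Gamma>; wf_fm T \<Gamma> \<phi>\<rbrakk> \<Longrightarrow> prov T \<Gamma> Bot \<phi>"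
| disjI1: "\<lbrakk>is_context T \<Gamma>; wf_fm T \<Gamma> \<phi>; wf_fm T \<Gamma> \<psi>\<rbrakk> \<Longrightarrow> prov T \<Gamma> \<phi> (Disj \<phi> \<psi>)"
| disjI2: "\<lbrakk>is_context T \<Gamma>; wf_fm T \<Gamma> \<phi>; wf_fm T \<Gamma> \<psi>\<rbrakk> \<Longrightarrow> prov T \<Gamma> \<psi> (Disj \<phi> \<psi>)"
| disjE: "\<lbrakk>prov T \<Gamma> \<phi> \<chi>; prov T \<Gamma> \<psi> \<chi>\<rbrakk> \<Longrightarrow> prov T \<Gamma> (Disj \<phi> \<psi>) \<chi>"
| exE: "\<lbrakk>wf_fm T \<Gamma> \<psi>; prov T (s # \<Gamma>) \<phi> (rename Suc \<psi>)\<rbrakk> \<Longrightarrow> prov T \<Gamma> (Ex s \<phi>) \<psi>"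
| exI: "prov T \<Gamma> (Ex s \<phi>) \<psi> \<Longrightarrow> prov T (s # \<Gamma>) \<phi> (rename Suc \<psi>)"
| dist: "\<lbrakk>is_context T \<Gamma>; wf_fm T \<Gamma> \<phi>; wf_fm T \<Gamma> \<psi>; wf_fm T \<Gamma> \<chi>\<rbrakk>
         \<Longrightarrow> prov T \<Gamma> (Conj \<phi> (Disj \<psi> \<chi>)) (Disj (Conj \<phi> \<psi>) (Conj \<phi> \<chi>))"
| frob: "\<lbrakk>is_context T \<Gamma>; wf_fm T \<Gamma> \<phi>; wf_fm T \<Gamma> (Ex s \<psi>)\<rbrakk>
         \<Longrightarrow> prov T \<Gamma> (Conj \<phi> (Ex s \<psi>)) (Ex s (Conj (rename Suc \<phi>) \<psi>))"


section \<open>The syntactic category\<close>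

text \<open>\<open>skip m k\<close> is the renaming from a context \<open>\<Gamma> @ \<Xi>\<close> into \<open>\<Gamma> @ \<Delta> @ \<Xi>\<close>, and \<open>swap m n\<close> the one
  from \<open>\<Gamma> @ \<Delta>\<close> into \<open>\<Delta> @ \<Gamma> @ \<Xi>\<close>, where \<open>m\<close> is the length of \<open>\<Gamma>\<close> and \<open>k\<close>, \<open>n\<close> are the length
  of \<open>\<Delta>\<close>.\<close>

definition skip :: "nat \<Rightarrow> nat \<Rightarrow> nat \<Rightarrow> nat" where
  "skip m k i = (if i < m then i else i + k)"

definition swap :: "nat \<Rightarrow> nat \<Rightarrow> nat \<Rightarrow> nat" where
  "swap m n i = (if i < m then i + n else i - m)"

text \<open>Existential quantification over the initial segment \<open>\<Delta>\<close> of a context \<open>\<Delta> @ \<Gamma>\<close>.\<close>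

definition Exs :: "'s list \<Rightarrow> ('s, 'f, 'r) fm \<Rightarrow> ('s, 'f, 'r) fm" where
  "Exs \<Delta> \<phi> = fold Ex \<Delta> \<phi>"

text \<open>\<open>eqs n\<close> equates the first block of \<open>n\<close> variables with the second one.\<close>

definition eqs :: "nat \<Rightarrow> ('s, 'f, 'r) fm" where
  "eqs n = foldr Conj (map (\<lambda>i. Eq (Var i) (Var (i + n))) [0..<n]) Top"

type_synonym ('s, 'f, 'r) fobj = "'s list \<times> ('s, 'f, 'r) fm"

type_synonym ('s, 'f, 'r) farr =
  "('s, 'f, 'r) fobj \<times> ('s, 'f, 'r) fm set \<times> ('s, 'f, 'r) fobj"

definition formulas_in_context :: "('s, 'f, 'r) pe_theory \<Rightarrow> ('s, 'f, 'r) fobj set" where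
  "formulas_in_context T = {(\<Gamma>, \<phi>). is_context T \<Gamma> \<and> wf_fm T \<Gamma> \<phi>}"

definition prov_eq ::
  "('s, 'f, 'r) pe_theory \<Rightarrow> 's list \<Rightarrow> ('s, 'f, 'r) fm \<Rightarrow> ('s, 'f, 'r) fm \<Rightarrow> bool" where
  "prov_eq T \<Gamma> \<phi> \<psi> \<longleftrightarrow> prov T \<Gamma> \<phi> \<psi> \<and> prov T \<Gamma> \<psi> \<phi>"

text \<open>A formula \<open>\<theta>\<close> representing an arrow from \<open>(\<Gamma>, \<phi>)\<close> to \<open>(\<Delta>, \<psi>)\<close> lives in the context
  \<open>\<Delta> @ \<Gamma>\<close>: the variables of the codomain come first.\<close>

definition functional ::
  "('s, 'f, 'r) pe_theory \<Rightarrow> ('s, 'f, 'r) fobj \<Rightarrow> ('s, 'f, 'r) fobj \<Rightarrow> ('s, 'f, 'r) fm \<Rightarrow> bool" where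
  "functional T a b \<theta> = (case (a, b) of ((\<Gamma>, \<phi>), (\<Delta>, \<psi>)) \<Rightarrow>
     (let n = length \<Delta> in
      wf_fm T (\<Delta> @ \<Gamma>) \<theta> \<and>
      prov T (\<Delta> @ \<Gamma>) \<theta> (Conj (rename (skip 0 n) \<phi>) \<psi>) \<and>
      prov T (\<Delta> @ \<Delta> @ \<Gamma>) (Conj (rename (skip n n) \<theta>) (rename (skip 0 n) \<theta>)) (eqs n) \<and>
      prov T \<Gamma> \<phi> (Exs \<Delta> \<theta>)))"

definition arrow_of ::
  "('s, 'f, 'r) pe_theory \<Rightarrow> ('s, 'f, 'r) fobj \<Rightarrow> ('s, 'f, 'r) fobj \<Rightarrow> ('s, 'f, 'r) fm \<Rightarrow> ('s, 'f, 'r) farr" where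
  "arrow_of T a b \<theta> = (a, {\<theta>'. prov_eq T (fst b @ fst a) \<theta> \<theta>'}, b)"

text \<open>For \<open>\<theta>\<close> in the context \<open>\<Delta> @ \<Gamma>\<close> and \<open>\<eta>\<close> in \<open>\<Xi> @ \<Delta>\<close>, this is \<open>\<exists>\<Delta>. \<theta> \<and> \<eta>\<close> in \<open>\<Xi> @ \<Gamma>\<close>.\<close>

definition comp_fm ::
  "'s list \<Rightarrow> 's list \<Rightarrow> ('s, 'f, 'r) fm \<Rightarrow> ('s, 'f, 'r) fm \<Rightarrow> ('s, 'f, 'r) fm" where
  "comp_fm \<Xi> \<Delta> \<eta> \<theta> =
     Exs \<Delta> (Conj (rename (skip (length \<Delta>) (length \<Xi>)) \<theta>) (rename (swap (length \<Xi>) (length \<Delta>)) \<eta>))"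

definition syntactic_category ::
  "('s, 'f, 'r) pe_theory \<Rightarrow> (('s, 'f, 'r) fobj, ('s, 'f, 'r) farr) category" where
  "syntactic_category T = \<lparr>Ob = formulas_in_context T,
     Ar = {arrow_of T a b \<theta> | a b \<theta>.
             a \<in> formulas_in_context T \<and> b \<in> formulas_in_context T \<and> functional T a b \<theta>},
     Dom = (\<lambda>(a, \<Theta>, b). a),
     Cod = (\<lambda>(a, \<Theta>, b). b),
     Id = (\<lambda>(\<Gamma>, \<phi>). arrow_of T (\<Gamma>, \<phi>) (\<Gamma>, \<phi>) (Conj \<phi> (eqs (length \<Gamma>)))),
     Comp = (\<lambda>(b', H, c) (a, \<Theta>, b).
       (a, {\<chi>. \<exists>\<eta>\<in>H. \<exists>\<theta>\<in>\<Theta>. prov_eq T (fst c @ fst a) (comp_fm (fst c) (fst b) \<eta> \<theta>) \<chi>}, c))\<rparr>"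

text \<open>Every \<open>T\<close>-provable equivalence relation \<open>\<epsilon>\<close> on a formula in context \<open>(\<Gamma>, \<phi>)\<close> is of the form
  \<open>f(x) = f(y)\<close> for a \<open>T\<close>-definable function \<open>f\<close>.\<close>

definition definable_equivalence ::
  "('s, 'f, 'r) pe_theory \<Rightarrow> 's list \<Rightarrow> ('s, 'f, 'r) fm \<Rightarrow> ('s, 'f, 'r) fm \<Rightarrow> bool" where
  "definable_equivalence T \<Gamma> \<phi> \<epsilon> \<longleftrightarrow> (let n = length \<Gamma> in
     wf_fm T (\<Gamma> @ \<Gamma>) \<epsilon> \<and>
     prov T (\<Gamma> @ \<Gamma>) \<epsilon> (Conj \<phi> (rename (skip 0 n) \<phi>)) \<and>
     prov T \<Gamma> \<phi> (rename (\<lambda>i. if i < n then i else i - n) \<epsilon>) \<and>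
     prov T (\<Gamma> @ \<Gamma>) \<epsilon> (rename (swap n n) \<epsilon>) \<and>
     prov T (\<Gamma> @ \<Gamma> @ \<Gamma>) (Conj \<epsilon> (rename (skip 0 n) \<epsilon>)) (rename (skip n n) \<epsilon>))"

definition eliminates_imaginaries :: "('s, 'f, 'r) pe_theory \<Rightarrow> bool" where
  "eliminates_imaginaries T \<longleftrightarrow>
     (\<forall>(\<Gamma>, \<phi>)\<in>formulas_in_context T. \<forall>\<epsilon>. definable_equivalence T \<Gamma> \<phi> \<epsilon> \<longrightarrow>
        (\<exists>\<Delta> \<psi> \<theta>. (\<Delta>, \<psi>) \<in> formulas_in_context T \<and> functional T (\<Gamma>, \<phi>) (\<Delta>, \<psi>) \<theta> \<and>
           prov_eq T (\<Gamma> @ \<Gamma>) \<epsilon> (Exs \<Delta> (Conj \<theta> (rename (skip (length \<Delta>) (length \<Gamma>)) \<theta>)))))"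


section \<open>The classifying topos\<close>

text \<open>\<open>Set(T)\<close> is the category of sheaves of small sets on the syntactic category for the coherent
  topology, whose basic covers are the finite families of arrows into \<open>(\<Gamma>, \<phi>)\<close> such that \<open>\<phi>\<close>
  provably implies the disjunction of their images.\<close>

definition image_fm ::
  "'s list \<Rightarrow> ('s, 'f, 'r) fobj \<Rightarrow> ('s, 'f, 'r) fm \<Rightarrow> ('s, 'f, 'r) fm" where
  "image_fm \<Gamma> d \<theta> = Exs (fst d) (rename (swap (length \<Gamma>) (length (fst d))) \<theta>)"

definition covers :: "('s, 'f, 'r) pe_theory \<Rightarrow> ('s, 'f, 'r) fobj \<Rightarrow> ('s, 'f, 'r) farr set \<Rightarrow> bool" where
  "covers T c K \<longleftrightarrow> c \<in> formulas_in_context T \<and>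
     (\<exists>xs. K = (\<lambda>(d, \<theta>). arrow_of T d c \<theta>) ` set xs \<and>
        (\<forall>(d, \<theta>)\<in>set xs. d \<in> formulas_in_context T \<and> functional T d c \<theta>) \<and>
        prov T (fst c) (snd c) (foldr Disj (map (\<lambda>(d, \<theta>). image_fm (fst c) d \<theta>) xs) Bot))"

record ('o, 'a, 'v) presheaf =
  Sec :: "'o \<Rightarrow> 'v set"
  Res :: "'a \<Rightarrow> 'v \<Rightarrow> 'v"

definition is_presheaf :: "('o, 'a, 'z) category_scheme \<Rightarrow> ('o, 'a, 'v) presheaf \<Rightarrow> bool" where
  "is_presheaf C F \<longleftrightarrow>
     (\<forall>c\<in>Ob C. small TYPE('v) (Sec F c)) \<and>
     (\<forall>f\<in>Ar C. Res F f \<in> Sec F (Cod C f) \<rightarrow> Sec F (Dom C f)) \<and>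
     (\<forall>c\<in>Ob C. \<forall>x\<in>Sec F c. Res F (Id C c) x = x) \<and>
     (\<forall>f\<in>Ar C. \<forall>g\<in>Ar C. Dom C g = Cod C f \<longrightarrow>
        (\<forall>x\<in>Sec F (Cod C g). Res F (g \<cdot>\<^bsub>C\<^esub> f) x = Res F f (Res F g x)))"

definition matching ::
  "('o, 'a, 'z) category_scheme \<Rightarrow> ('o, 'a, 'v) presheaf \<Rightarrow> 'a set \<Rightarrow> ('a \<Rightarrow> 'v) \<Rightarrow> bool" where
  "matching C F K x \<longleftrightarrow>
     (\<forall>f\<in>K. x f \<in> Sec F (Dom C f)) \<and>
     (\<forall>f\<in>K. \<forall>g\<in>K. \<forall>b\<in>Ob C. \<forall>h\<in>hom C b (Dom C f). \<forall>k\<in>hom C b (Dom C g).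
        f \<cdot>\<^bsub>C\<^esub> h = g \<cdot>\<^bsub>C\<^esub> k \<longrightarrow> Res F h (x f) = Res F k (x g))"

definition is_sheaf ::
  "('s, 'f, 'r) pe_theory \<Rightarrow> (('s, 'f, 'r) fobj, ('s, 'f, 'r) farr, 'v) presheaf \<Rightarrow> bool" where
  "is_sheaf T F \<longleftrightarrow> is_presheaf (syntactic_category T) F \<and>
     (\<forall>c K x. covers T c K \<and> matching (syntactic_category T) F K x \<longrightarrow>
        (\<exists>!y. y \<in> Sec F c \<and> (\<forall>f\<in>K. Res F f y = x f)))"

definition natural_transformations ::
  "('o, 'a, 'z) category_scheme \<Rightarrow> ('o, 'a, 'v) presheaf \<Rightarrow> ('o, 'a, 'v) presheaf \<Rightarrow>
   ('o \<Rightarrow> 'v \<Rightarrow> 'v) set" where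
  "natural_transformations C F G =
     {\<eta> \<in> (\<Pi>\<^sub>E c\<in>Ob C. Sec F c \<rightarrow>\<^sub>E Sec G c).
        \<forall>f\<in>Ar C. \<forall>x\<in>Sec F (Cod C f). \<eta> (Dom C f) (Res F f x) = Res G f (\<eta> (Cod C f) x)}"

type_synonym ('s, 'f, 'r, 'v) tobj = "(('s, 'f, 'r) fobj, ('s, 'f, 'r) farr, 'v) presheaf"

type_synonym ('s, 'f, 'r, 'v) tarr =
  "('s, 'f, 'r, 'v) tobj \<times> (('s, 'f, 'r) fobj \<Rightarrow> 'v \<Rightarrow> 'v) \<times> ('s, 'f, 'r, 'v) tobj"

definition classifying_topos ::
  "('s, 'f, 'r) pe_theory \<Rightarrow> (('s, 'f, 'r, 'v) tobj, ('s, 'f, 'r, 'v) tarr) category" where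
  "classifying_topos T = (let S = syntactic_category T in
     \<lparr>Ob = {F. is_sheaf T F},
      Ar = {(F, \<eta>, G). is_sheaf T F \<and> is_sheaf T G \<and> \<eta> \<in> natural_transformations S F G},
      Dom = (\<lambda>(F, \<eta>, G). F),
      Cod = (\<lambda>(F, \<eta>, G). G),
      Id = (\<lambda>F. (F, \<lambda>c\<in>Ob S. \<lambda>x\<in>Sec F c. x, F)),
      Comp = (\<lambda>(G', \<theta>, H) (F, \<eta>, G). (F, \<lambda>c\<in>Ob S. \<lambda>x\<in>Sec F c. \<theta> c (\<eta> c x), H))\<rparr>)"

definition small_theory :: "'v itself \<Rightarrow> ('s, 'f, 'r) pe_theory \<Rightarrow> bool" where
  "small_theory V T \<longleftrightarrow> small V (Sorts T) \<and> small V (Funs T) \<and> small V (Rels T)"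

end

(* The kernel pair of f = (L concat)^dagger is a congruence for concatenation, so the words act on its
   coequaliser Q by q(v) |-> q(v w), and the resulting automaton with states Q recognizes L.
   Conversely, if an automaton with states S and run r recognizes L, then f = g r for some g from S
   to the power object P of words. If S is a subobject of a compact object C, then g extends to C
   because P is injective. The image of C in P is compact, being a quotient of C, and it contains the
   image of f, which is Q. A quotient of a compact object is compact because the coprojections of a
   filtered colimit of monomorphisms are monic, so that a map into the colimit factors through a stage
   as soon as its restriction along a cover does. *)
theory Submission
  imports Defs
begin

section \<open>Generalised elements in an elementary topos\<close>

text \<open>The structure consists of finite limits, exponentials and a classifier, so images and
  descent have to be built from these. Internal formulas are maps into \<Omega> and are handled
  through the generalised elements of which they hold. Images are intersections of subobjects,
  formed with an internal quantifier; descent along a cover goes through singletons. A quotient of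
  \<open>S\<close> could be placed inside a quotient of \<open>C\<close> by a pushout; extending
  \<open>g\<close> to \<open>C\<close> takes the place of this pushout. The quotient
  \<open>Q\<close> is given by a coequaliser, whereas compactness is proved for a subobject of
  \<open>P\<close>; the link is an embedding of \<open>Q\<close> into the image of \<open>f\<close>.
  The action of words descends to \<open>Q\<close> because a product with a fixed object has a right
  adjoint and therefore preserves coequalisers.\<close>

locale etopos =
  fixes E :: "('o, 'a, 'z) topos_scheme" (structure)
  assumes topos: "elementary_topos E"
begin

section \<open>Composition and monomorphisms\<close>

lemma category: "is_category E"
  using topos by (simp add: elementary_topos_def)

lemma category_laws:
  shows "f \<in> Ar E \<Longrightarrow> Dom E f \<in> Ob E \<and> Cod E f \<in> Ob E"
    and "A \<in> Ob E \<Longrightarrow> Id E A \<in> hom E A A"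
    and "\<lbrakk>f \<in> Ar E; g \<in> Ar E; Dom E g = Cod E f\<rbrakk> \<Longrightarrow> g \<cdot> f \<in> hom E (Dom E f) (Cod E g)"
    and "f \<in> Ar E \<Longrightarrow> f \<cdot> Id E (Dom E f) = f \<and> Id E (Cod E f) \<cdot> f = f"
    and "\<lbrakk>f \<in> Ar E; g \<in> Ar E; h \<in> Ar E; Dom E g = Cod E f; Dom E h = Cod E g\<rbrakk> \<Longrightarrow> (h \<cdot> g) \<cdot> f = h \<cdot> (g \<cdot> f)"
  using category unfolding is_category_def by blast+

text \<open>As a simp rule it splits typing goals into conditions on \<open>Dom\<close> and
  \<open>Cod\<close>, the form that the other simp rules expect. Where hom-sets occur as sets in
  their own right, it is switched off.\<close>

lemma mem_hom [simp]: "f \<in> hom E A B \<longleftrightarrow> f \<in> Ar E \<and> Dom E f = A \<and> Cod E f = B"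
  by (simp add: hom_def)

lemma Ob_Dom_Cod [simp]:
  assumes "f \<in> Ar E"
  shows "Dom E f \<in> Ob E" "Cod E f \<in> Ob E"
  using category_laws(1)[OF assms] by simp_all

lemma Id_simps [simp]:
  assumes "A \<in> Ob E"
  shows "Id E A \<in> Ar E" "Dom E (Id E A) = A" "Cod E (Id E A) = A"
  using category_laws(2)[OF assms] by simp_all

lemma Comp_simps [simp]:
  assumes "f \<in> Ar E" "g \<in> Ar E" "Dom E g = Cod E f"
  shows "g \<cdot> f \<in> Ar E" "Dom E (g \<cdot> f) = Dom E f" "Cod E (g \<cdot> f) = Cod E g"
  using category_laws(3)[OF assms] by simp_all

lemma Comp_Id [simp]:
  assumes "f \<in> Ar E"
  shows "Dom E f = A \<Longrightarrow> f \<cdot> Id E A = f" "Cod E f = B \<Longrightarrow> Id E B \<cdot> f = f"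
  using category_laws(4)[OF assms] by auto

lemmas Comp_assoc [simp] = category_laws(5)

lemma monic_Ar [simp]: "monic E m \<Longrightarrow> m \<in> Ar E"
  by (simp add: monic_def)

text \<open>That \<open>f\<close> and \<open>g\<close> have the same domain is read off from the
  equation of composites.\<close>

lemma monic_cancel:
  assumes "monic E m" "f \<in> Ar E" "g \<in> Ar E" "Cod E f = Dom E m" "Cod E g = Dom E m"
    and eq: "m \<cdot> f = m \<cdot> g"
  shows "f = g"
proof -
  have "Dom E (m \<cdot> f) = Dom E f" "Dom E (m \<cdot> g) = Dom E g"
    using assms(1-5) by simp_all
  then have "f \<in> hom E (Dom E g) (Dom E m)" "g \<in> hom E (Dom E g) (Dom E m)"
    using eq assms(2-5) by simp_all
  then show ?thesis
    using assms(1) eq unfolding monic_def by blast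
qed

lemma monicI:
  assumes "m \<in> Ar E"
    and "\<And>f g. \<lbrakk>f \<in> Ar E; g \<in> Ar E; Dom E f = Dom E g; Cod E f = Dom E m; Cod E g = Dom E m; m \<cdot> f = m \<cdot> g\<rbrakk> \<Longrightarrow> f = g"
  shows "monic E m"
  unfolding monic_def using assms by simp

lemma monic_Comp:
  assumes "monic E m" "monic E n" "Dom E n = Cod E m"
  shows "monic E (n \<cdot> m)"
proof (rule monicI)
  show "n \<cdot> m \<in> Ar E" using assms by simp
  fix f g
  assume "f \<in> Ar E" "g \<in> Ar E" "Dom E f = Dom E g" "Cod E f = Dom E (n \<cdot> m)" "Cod E g = Dom E (n \<cdot> m)"
    "(n \<cdot> m) \<cdot> f = (n \<cdot> m) \<cdot> g"
  then show "f = g"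
    using assms monic_cancel[of n "m \<cdot> f" "m \<cdot> g"] monic_cancel[of m f g] by simp
qed

lemma monic_of_Comp:
  assumes "monic E (n \<cdot> m)" "m \<in> Ar E" "n \<in> Ar E" "Dom E n = Cod E m"
  shows "monic E m"
proof (rule monicI)
  fix f g
  assume *: "f \<in> Ar E" "g \<in> Ar E" "Dom E f = Dom E g" "Cod E f = Dom E m" "Cod E g = Dom E m"
    "m \<cdot> f = m \<cdot> g"
  then have "(n \<cdot> m) \<cdot> f = (n \<cdot> m) \<cdot> g"
    using assms by simp
  then show "f = g"
    using * assms monic_cancel[of "n \<cdot> m" f g] by simp
qed (use assms in simp)

lemma monic_Id: "A \<in> Ob E \<Longrightarrow> monic E (Id E A)"
  by (rule monicI) auto

section \<open>The terminal object and binary products\<close>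

lemma One_Ob [simp]: "One E \<in> Ob E"
  using topos by (simp add: elementary_topos_def is_terminal_def)

lemma terminal: "X \<in> Ob E \<Longrightarrow> \<exists>!f. f \<in> hom E X (One E)"
  using topos by (simp add: elementary_topos_def is_terminal_def)

lemma bang_simps [simp]:
  assumes "X \<in> Ob E"
  shows "bang E X \<in> Ar E" "Dom E (bang E X) = X" "Cod E (bang E X) = One E"
  using theI'[OF terminal[OF assms]] by (simp_all add: bang_def)

lemma bang_unique: "f \<in> Ar E \<Longrightarrow> Cod E f = One E \<Longrightarrow> f = bang E (Dom E f)"
  using terminal[of "Dom E f"] bang_simps[of "Dom E f"] by (metis Ob_Dom_Cod(1) mem_hom)

lemma bang_Comp [simp]: "f \<in> Ar E \<Longrightarrow> X = Cod E f \<Longrightarrow> bang E X \<cdot> f = bang E (Dom E f)"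
  using bang_unique[of "bang E X \<cdot> f"] by simp

lemma product: "A \<in> Ob E \<Longrightarrow> B \<in> Ob E \<Longrightarrow> is_product E A B (Prod E A B) (Pr1 E A B) (Pr2 E A B)"
  using topos by (simp add: elementary_topos_def)

lemma Prod_simps [simp]:
  assumes "A \<in> Ob E" "B \<in> Ob E"
  shows "Prod E A B \<in> Ob E"
    "Pr1 E A B \<in> Ar E" "Dom E (Pr1 E A B) = Prod E A B" "Cod E (Pr1 E A B) = A"
    "Pr2 E A B \<in> Ar E" "Dom E (Pr2 E A B) = Prod E A B" "Cod E (Pr2 E A B) = B"
  using product[OF assms] by (auto simp: is_product_def)

lemma pair_ex1:
  assumes "f \<in> Ar E" "g \<in> Ar E" "Dom E f = Dom E g"
  shows "\<exists>!h. h \<in> hom E (Dom E f) (Prod E (Cod E f) (Cod E g)) \<and>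
    Pr1 E (Cod E f) (Cod E g) \<cdot> h = f \<and> Pr2 E (Cod E f) (Cod E g) \<cdot> h = g"
  using product[of "Cod E f" "Cod E g"] assms unfolding is_product_def by simp

lemma pair_simps [simp]:
  assumes "f \<in> Ar E" "g \<in> Ar E" "Dom E f = Dom E g"
  shows "pair E f g \<in> Ar E" "Dom E (pair E f g) = Dom E g"
    "Cod E (pair E f g) = Prod E (Cod E f) (Cod E g)"
    "A = Cod E f \<Longrightarrow> B = Cod E g \<Longrightarrow> Pr1 E A B \<cdot> pair E f g = f"
    "A = Cod E f \<Longrightarrow> B = Cod E g \<Longrightarrow> Pr2 E A B \<cdot> pair E f g = g"
  using theI'[OF pair_ex1[OF assms]] assms by (simp_all add: pair_def Let_def)

lemma Prod_ext:
  assumes "h \<in> Ar E" "h' \<in> Ar E" "Cod E h = Prod E A B" "Cod E h' = Prod E A B" "A \<in> Ob E" "B \<in> Ob E"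
    and "Pr1 E A B \<cdot> h = Pr1 E A B \<cdot> h'" "Pr2 E A B \<cdot> h = Pr2 E A B \<cdot> h'"
  shows "h = h'"
proof -
  have "Dom E (Pr1 E A B \<cdot> h) = Dom E h" "Dom E (Pr1 E A B \<cdot> h') = Dom E h'"
    using assms(1-6) by simp_all
  then have "Dom E h = Dom E h'"
    using assms(7) by metis
  moreover have "\<exists>!k. k \<in> hom E (Dom E h) (Prod E A B) \<and> Pr1 E A B \<cdot> k = Pr1 E A B \<cdot> h \<and> Pr2 E A B \<cdot> k = Pr2 E A B \<cdot> h"
    using pair_ex1[of "Pr1 E A B \<cdot> h" "Pr2 E A B \<cdot> h"] assms(1-6) by simp
  moreover have "h \<in> hom E (Dom E h) (Prod E A B)" "h' \<in> hom E (Dom E h') (Prod E A B)"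
    using assms by simp_all
  ultimately show ?thesis
    using assms(7,8) by metis
qed

lemma pair_Comp [simp]:
  assumes "f \<in> Ar E" "g \<in> Ar E" "Dom E f = Dom E g" "h \<in> Ar E" "Cod E h = Dom E g"
  shows "pair E f g \<cdot> h = pair E (f \<cdot> h) (g \<cdot> h)"
proof (rule Prod_ext[of _ _ "Cod E f" "Cod E g"])
  have "Pr1 E (Cod E f) (Cod E g) \<cdot> (pair E f g \<cdot> h) = (Pr1 E (Cod E f) (Cod E g) \<cdot> pair E f g) \<cdot> h"
    using assms by (subst Comp_assoc) simp_all
  then show "Pr1 E (Cod E f) (Cod E g) \<cdot> (pair E f g \<cdot> h) = Pr1 E (Cod E f) (Cod E g) \<cdot> pair E (f \<cdot> h) (g \<cdot> h)"
    using assms by simp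
  have "Pr2 E (Cod E f) (Cod E g) \<cdot> (pair E f g \<cdot> h) = (Pr2 E (Cod E f) (Cod E g) \<cdot> pair E f g) \<cdot> h"
    using assms by (subst Comp_assoc) simp_all
  then show "Pr2 E (Cod E f) (Cod E g) \<cdot> (pair E f g \<cdot> h) = Pr2 E (Cod E f) (Cod E g) \<cdot> pair E (f \<cdot> h) (g \<cdot> h)"
    using assms by simp
qed (use assms in simp_all)

lemma pair_Pr [simp]:
  assumes "A \<in> Ob E" "B \<in> Ob E"
  shows "pair E (Pr1 E A B) (Pr2 E A B) = Id E (Prod E A B)"
  by (rule Prod_ext[of _ _ A B]) (use assms in simp_all)

lemma pair_eta:
  assumes "h \<in> Ar E" "Cod E h = Prod E A B" "A \<in> Ob E" "B \<in> Ob E"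
  shows "pair E (Pr1 E A B \<cdot> h) (Pr2 E A B \<cdot> h) = h"
  by (rule Prod_ext[of _ _ A B]) (use assms in simp_all)

lemma pair_eq_iff:
  assumes "f \<in> Ar E" "g \<in> Ar E" "Dom E f = Dom E g" "f' \<in> Ar E" "g' \<in> Ar E" "Dom E f' = Dom E g'"
    "Cod E f = Cod E f'" "Cod E g = Cod E g'"
  shows "pair E f g = pair E f' g' \<longleftrightarrow> f = f' \<and> g = g'"
proof
  assume *: "pair E f g = pair E f' g'"
  have "Pr1 E (Cod E f) (Cod E g) \<cdot> pair E f g = f" "Pr2 E (Cod E f) (Cod E g) \<cdot> pair E f g = g"
    using assms by simp_all
  moreover have "Pr1 E (Cod E f) (Cod E g) \<cdot> pair E f' g' = f'" "Pr2 E (Cod E f) (Cod E g) \<cdot> pair E f' g' = g'"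
    using assms by simp_all
  ultimately show "f = f' \<and> g = g'"
    using * by simp
qed simp

section \<open>Exponentials and transposes\<close>

lemma exponential:
  assumes "A \<in> Ob E" "B \<in> Ob E"
  shows "Exp E A B \<in> Ob E" "Ev E A B \<in> hom E (Prod E (Exp E A B) A) B"
    "X \<in> Ob E \<Longrightarrow> f \<in> hom E (Prod E X A) B \<Longrightarrow> \<exists>!h. is_transpose E X A B f h"
  using topos assms unfolding elementary_topos_def by simp_all

lemma Exp_simps [simp]:
  assumes "A \<in> Ob E" "B \<in> Ob E"
  shows "Exp E A B \<in> Ob E" "Ev E A B \<in> Ar E" "Dom E (Ev E A B) = Prod E (Exp E A B) A" "Cod E (Ev E A B) = B"
  using exponential[OF assms] by auto

lemma apply_exp_simps [simp]:
  assumes "k \<in> Ar E" "a \<in> Ar E" "Dom E k = Dom E a" "Cod E k = Exp E A B" "Cod E a = A" "B \<in> Ob E"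
  shows "apply_exp E A B k a \<in> Ar E" "Dom E (apply_exp E A B k a) = Dom E a" "Cod E (apply_exp E A B k a) = B"
    "t \<in> Ar E \<Longrightarrow> Cod E t = Dom E a \<Longrightarrow> apply_exp E A B k a \<cdot> t = apply_exp E A B (k \<cdot> t) (a \<cdot> t)"
proof -
  have "A \<in> Ob E" using assms by auto
  then show "apply_exp E A B k a \<in> Ar E" "Dom E (apply_exp E A B k a) = Dom E a" "Cod E (apply_exp E A B k a) = B"
    "t \<in> Ar E \<Longrightarrow> Cod E t = Dom E a \<Longrightarrow> apply_exp E A B k a \<cdot> t = apply_exp E A B (k \<cdot> t) (a \<cdot> t)"
    using assms by (simp_all add: apply_exp_def)
qed

text \<open>The last rule is the beta law at arbitrary generalised elements. The definition gives it
  at the two projections; precomposing with \<open>pair E x a\<close> yields the rest.\<close>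

lemma transpose_simps [simp]:
  assumes "X \<in> Ob E" "A \<in> Ob E" "f \<in> Ar E" "Dom E f = Prod E X A" "Cod E f = B"
  shows "transpose E X A B f \<in> Ar E" "Dom E (transpose E X A B f) = X"
    "Cod E (transpose E X A B f) = Exp E A B"
    "\<lbrakk>x \<in> Ar E; Cod E x = X; a \<in> Ar E; Cod E a = A; Dom E x = Dom E a\<rbrakk> \<Longrightarrow>
       apply_exp E A B (transpose E X A B f \<cdot> x) a = f \<cdot> pair E x a"
proof -
  have B: "B \<in> Ob E" using assms by auto
  have "is_transpose E X A B f (transpose E X A B f)"
    unfolding transpose_def by (rule theI'[OF exponential(3)]) (use assms B in auto)
  then have *: "transpose E X A B f \<in> Ar E" "Dom E (transpose E X A B f) = X"
    "Cod E (transpose E X A B f) = Exp E A B"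
    and **: "apply_exp E A B (transpose E X A B f \<cdot> Pr1 E X A) (Pr2 E X A) = f"
    by (simp_all add: is_transpose_def)
  then show "transpose E X A B f \<in> Ar E" "Dom E (transpose E X A B f) = X"
    "Cod E (transpose E X A B f) = Exp E A B"
    by simp_all
  assume x: "x \<in> Ar E" "Cod E x = X" "a \<in> Ar E" "Cod E a = A" "Dom E x = Dom E a"
  have "f \<cdot> pair E x a = apply_exp E A B (transpose E X A B f \<cdot> Pr1 E X A) (Pr2 E X A) \<cdot> pair E x a"
    using ** by simp
  also have "\<dots> = apply_exp E A B (transpose E X A B f \<cdot> x) a"
    using * B assms x by simp
  finally show "apply_exp E A B (transpose E X A B f \<cdot> x) a = f \<cdot> pair E x a" ..
qed

lemma Exp_ext:
  assumes "h \<in> hom E X (Exp E A B)" "h' \<in> hom E X (Exp E A B)" "A \<in> Ob E" "B \<in> Ob E"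
    and "apply_exp E A B (h \<cdot> Pr1 E X A) (Pr2 E X A) = apply_exp E A B (h' \<cdot> Pr1 E X A) (Pr2 E X A)"
  shows "h = h'"
proof -
  let ?f = "apply_exp E A B (h \<cdot> Pr1 E X A) (Pr2 E X A)"
  have X: "X \<in> Ob E" using assms by auto
  have "?f \<in> hom E (Prod E X A) B"
    using assms X by simp
  then have "\<exists>!h. is_transpose E X A B ?f h"
    using exponential(3) assms X by blast
  then show ?thesis
    using assms by (auto simp: is_transpose_def)
qed

text \<open>Transposition is natural in \<open>X\<close>, so two elements of an exponential agree
  exactly when their values at the generic argument \<open>Pr2 E T A\<close> agree.\<close>

lemma transpose_eq_iff:
  assumes "f \<in> hom E (Prod E X A) B" "g \<in> hom E (Prod E X A) B" "X \<in> Ob E" "A \<in> Ob E" "x \<in> hom E T X" "x' \<in> hom E T X"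
  shows "transpose E X A B f \<cdot> x = transpose E X A B g \<cdot> x' \<longleftrightarrow>
    f \<cdot> pair E (x \<cdot> Pr1 E T A) (Pr2 E T A) = g \<cdot> pair E (x' \<cdot> Pr1 E T A) (Pr2 E T A)" (is "?l = ?r \<longleftrightarrow> ?P")
proof -
  have B: "B \<in> Ob E" "T \<in> Ob E" using assms by auto
  have f: "?l \<in> hom E T (Exp E A B)" "?r \<in> hom E T (Exp E A B)"
    using assms B by auto
  have "?l = ?r \<longleftrightarrow> apply_exp E A B (?l \<cdot> Pr1 E T A) (Pr2 E T A) = apply_exp E A B (?r \<cdot> Pr1 E T A) (Pr2 E T A)"
    using Exp_ext[OF f] assms(4) B by metis
  also have "apply_exp E A B (?l \<cdot> Pr1 E T A) (Pr2 E T A) = f \<cdot> pair E (x \<cdot> Pr1 E T A) (Pr2 E T A)"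
    using assms B by simp
  also have "apply_exp E A B (?r \<cdot> Pr1 E T A) (Pr2 E T A) = g \<cdot> pair E (x' \<cdot> Pr1 E T A) (Pr2 E T A)"
    using assms B by simp
  finally show ?thesis .
qed

subsection \<open>Predicates\<close>

text \<open>The hypothesis covers the generic case, in which \<open>t\<close> and \<open>a\<close>
  are the projections, and there \<open>Exp_ext\<close> applies.\<close>

lemma Exp_ext_elements:
  assumes "h \<in> hom E X (Exp E A B)" "h' \<in> hom E X (Exp E A B)" "A \<in> Ob E" "B \<in> Ob E"
    and "\<And>T t a. \<lbrakk>t \<in> hom E T X; a \<in> hom E T A\<rbrakk> \<Longrightarrow> apply_exp E A B (h \<cdot> t) a = apply_exp E A B (h' \<cdot> t) a"
  shows "h = h'"
proof (rule Exp_ext[OF assms(1-4)])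
  have "X \<in> Ob E" using assms(1) by auto
  then show "apply_exp E A B (h \<cdot> Pr1 E X A) (Pr2 E X A) = apply_exp E A B (h' \<cdot> Pr1 E X A) (Pr2 E X A)"
    by (intro assms(5)) (use assms(3) in simp_all)
qed

section \<open>Pullbacks\<close>

lemma pullback_ex: "f \<in> Ar E \<Longrightarrow> g \<in> Ar E \<Longrightarrow> Cod E f = Cod E g \<Longrightarrow> \<exists>p q. is_pullback E f g p q"
  using topos by (simp add: elementary_topos_def)

lemma pullbackD:
  assumes "is_pullback E f g p q"
  shows "f \<in> Ar E" "g \<in> Ar E" "p \<in> Ar E" "q \<in> Ar E" "Cod E f = Cod E g" "Dom E p = Dom E q"
    "Cod E p = Dom E f" "Cod E q = Dom E g" "f \<cdot> p = g \<cdot> q"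
  using assms unfolding is_pullback_def by simp_all

lemma pullback_ex1:
  assumes "is_pullback E f g p q" "a \<in> hom E X (Dom E f)" "b \<in> hom E X (Dom E g)" "f \<cdot> a = g \<cdot> b"
  shows "\<exists>!h. h \<in> hom E X (Dom E p) \<and> p \<cdot> h = a \<and> q \<cdot> h = b"
proof -
  have "X \<in> Ob E" using assms(2) by auto
  then show ?thesis
    using assms unfolding is_pullback_def by blast
qed

lemma pullback_monic:
  assumes pb: "is_pullback E f g p q" and g: "monic E g"
  shows "monic E p"
proof (rule monicI)
  note p = pullbackD[OF pb]
  show "p \<in> Ar E" by fact
  fix x y
  assume *: "x \<in> Ar E" "y \<in> Ar E" "Dom E x = Dom E y" "Cod E x = Dom E p" "Cod E y = Dom E p" "p \<cdot> x = p \<cdot> y"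
  have "g \<cdot> (q \<cdot> x) = f \<cdot> (p \<cdot> x)"
    using p * Comp_assoc[of x q g] Comp_assoc[of x p f] by simp
  also have "\<dots> = g \<cdot> (q \<cdot> y)"
    using p * Comp_assoc[of y q g] Comp_assoc[of y p f] by simp
  finally have q: "q \<cdot> x = q \<cdot> y"
    by (rule monic_cancel[OF g, rotated -1]) (use p * in simp_all)
  have "\<exists>!h. h \<in> hom E (Dom E x) (Dom E p) \<and> p \<cdot> h = p \<cdot> x \<and> q \<cdot> h = q \<cdot> x"
  proof (rule pullback_ex1[OF pb])
    show "f \<cdot> (p \<cdot> x) = g \<cdot> (q \<cdot> x)"
      using p * Comp_assoc[of x q g] Comp_assoc[of x p f] by simp
  qed (use p * in simp_all)
  moreover have "x \<in> hom E (Dom E x) (Dom E p)" "y \<in> hom E (Dom E x) (Dom E p)"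
    using * by simp_all
  ultimately show "x = y"
    using q *(6) by metis
qed

section \<open>The subobject classifier: comprehension, equality and quantification\<close>

lemma Omega_simps [simp]:
  "Omega E \<in> Ob E" "Truth E \<in> Ar E" "Dom E (Truth E) = One E" "Cod E (Truth E) = Omega E"
  using topos by (simp_all add: elementary_topos_def)

text \<open>The equation \<open>c \<cdot> b = true_at T\<close> is the forcing relation of
  Kripke-Joyal semantics: the predicate \<open>c\<close> holds of the element \<open>b\<close> at
  stage \<open>T\<close>.\<close>

definition true_at :: "'o \<Rightarrow> 'a" where
  "true_at X = Truth E \<cdot> bang E X"

lemma true_at_simps [simp]:
  assumes "X \<in> Ob E"
  shows "true_at X \<in> Ar E" "Dom E (true_at X) = X" "Cod E (true_at X) = Omega E"
    "t \<in> Ar E \<Longrightarrow> Cod E t = X \<Longrightarrow> true_at X \<cdot> t = true_at (Dom E t)"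
  using assms by (simp_all add: true_at_def)

text \<open>The leg into the terminal object carries no information, and uniqueness of the
  factorisation is monicity of \<open>m\<close>. What remains of the pullback is comprehension on
  generalised elements.\<close>

lemma classifies_iff:
  assumes m: "monic E m" and c: "c \<in> hom E (Cod E m) (Omega E)"
  shows "classifies E c m \<longleftrightarrow>
    (\<forall>T. \<forall>b \<in> hom E T (Cod E m). c \<cdot> b = true_at T \<longleftrightarrow> (\<exists>h \<in> hom E T (Dom E m). m \<cdot> h = b))"
    (is "_ \<longleftrightarrow> ?R")
proof
  assume "classifies E c m"
  then have pb: "is_pullback E c (Truth E) m (bang E (Dom E m))"
    by (simp add: classifies_def)
  show ?R
  proof (intro allI ballI iffI)
    fix T b assume b: "b \<in> hom E T (Cod E m)"
    then have T: "T \<in> Ob E" by auto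
    {
      assume "c \<cdot> b = true_at T"
      then have "\<exists>!h. h \<in> hom E T (Dom E m) \<and> m \<cdot> h = b \<and> bang E (Dom E m) \<cdot> h = bang E T"
        by (intro pullback_ex1[OF pb]) (use b T c in \<open>simp_all add: true_at_def\<close>)
      then show "\<exists>h\<in>hom E T (Dom E m). m \<cdot> h = b"
        by blast
    next
      assume "\<exists>h\<in>hom E T (Dom E m). m \<cdot> h = b"
      then obtain h where h: "h \<in> hom E T (Dom E m)" "b = m \<cdot> h"
        by blast
      have "c \<cdot> b = (c \<cdot> m) \<cdot> h"
        using h c m by simp
      also have "c \<cdot> m = true_at (Dom E m)"
        using pullbackD(9)[OF pb] by (simp add: true_at_def)
      finally show "c \<cdot> b = true_at T"
        using h m by simp
    }
  qed
next
  assume R: ?R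
  have mD: "m \<in> Ar E" "Dom E m \<in> Ob E" using m by simp_all
  show "classifies E c m"
    unfolding classifies_def is_pullback_def
  proof (intro HOL.conjI ballI impI)
    have "c \<cdot> m = true_at (Dom E m)"
      using R[rule_format, of m "Dom E m"] mD by (metis Comp_Id(1) Id_simps mem_hom)
    then show "c \<cdot> m = Truth E \<cdot> bang E (Dom E m)"
      by (simp add: true_at_def)
    fix X a b
    assume *: "X \<in> Ob E" "a \<in> hom E X (Dom E c)" "b \<in> hom E X (Dom E (Truth E))" "c \<cdot> a = Truth E \<cdot> b"
    then have b: "b = bang E X"
      using bang_unique[of b] by simp
    then have "c \<cdot> a = true_at X"
      using * by (simp add: true_at_def)
    moreover have "a \<in> hom E X (Cod E m)"
      using * c by simp
    ultimately obtain h where h: "h \<in> hom E X (Dom E m)" "m \<cdot> h = a"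
      using R by blast
    show "\<exists>!h. h \<in> hom E X (Dom E m) \<and> m \<cdot> h = a \<and> bang E (Dom E m) \<cdot> h = b"
    proof (rule ex1I)
      show "h \<in> hom E X (Dom E m) \<and> m \<cdot> h = a \<and> bang E (Dom E m) \<cdot> h = b"
        using h b mD by simp
      show "h' = h" if "h' \<in> hom E X (Dom E m) \<and> m \<cdot> h' = a \<and> bang E (Dom E m) \<cdot> h' = b" for h'
        by (rule monic_cancel[OF m]) (use h that in simp_all)
    qed
  qed (use c mD in simp_all)
qed

lemma classifier_ex1: "monic E m \<Longrightarrow> \<exists>!c. c \<in> hom E (Cod E m) (Omega E) \<and> classifies E c m"
  using topos by (simp add: elementary_topos_def)

text \<open>Pull back \<open>Truth\<close>, which is monic because its domain is terminal.\<close>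

lemma comprehension:
  assumes c: "c \<in> hom E B (Omega E)"
  obtains m where "monic E m" "Cod E m = B" "classifies E c m"
    "\<And>T b. b \<in> hom E T B \<Longrightarrow> c \<cdot> b = true_at T \<longleftrightarrow> (\<exists>h \<in> hom E T (Dom E m). m \<cdot> h = b)"
proof -
  obtain m q where pb: "is_pullback E c (Truth E) m q"
    using pullback_ex[of c "Truth E"] c by auto
  have "monic E (Truth E)"
  proof (rule monicI)
    show "f = g" if "f \<in> Ar E" "g \<in> Ar E" "Dom E f = Dom E g" "Cod E f = Dom E (Truth E)" "Cod E g = Dom E (Truth E)" for f g
      using that bang_unique[of f] bang_unique[of g] by simp
  qed simp
  then have m: "monic E m"
    using pullback_monic[OF pb] by simp
  note p = pullbackD[OF pb]
  have "q = bang E (Dom E m)"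
    using p bang_unique[of q] by simp
  then have cl: "classifies E c m"
    using pb by (simp add: classifies_def)
  have "Cod E m = B" using p c by simp
  with that[of m] m cl classifies_iff[OF m, of c] c show ?thesis
    by simp
qed

text \<open>Propositional extensionality: both maps classify the same subobject, and a classifying
  map is unique.\<close>

lemma Omega_ext:
  assumes c: "c \<in> hom E B (Omega E)" "c' \<in> hom E B (Omega E)"
    and eq: "\<And>T b. b \<in> hom E T B \<Longrightarrow> c \<cdot> b = true_at T \<longleftrightarrow> c' \<cdot> b = true_at T"
  shows "c = c'"
proof -
  obtain m where m: "monic E m" "Cod E m = B" "classifies E c m"
    using comprehension[OF c(1)] by metis
  then have "classifies E c' m"
    using classifies_iff[OF m(1)] c eq by blast
  then show ?thesis
    using classifier_ex1[OF m(1)] m c by metis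
qed

definition char :: "'a \<Rightarrow> 'a" where
  "char m = (THE c. c \<in> hom E (Cod E m) (Omega E) \<and> classifies E c m)"

lemma char_simps [simp]:
  assumes "monic E m"
  shows "char m \<in> Ar E" "Dom E (char m) = Cod E m" "Cod E (char m) = Omega E"
    "classifies E (char m) m"
  using theI'[OF classifier_ex1[OF assms]] by (simp_all add: char_def)

lemma char_iff:
  assumes "monic E m" "b \<in> hom E T (Cod E m)"
  shows "char m \<cdot> b = true_at T \<longleftrightarrow> (\<exists>h \<in> hom E T (Dom E m). m \<cdot> h = b)"
proof -
  have "classifies E (char m) m \<longleftrightarrow>
    (\<forall>T. \<forall>b \<in> hom E T (Cod E m). char m \<cdot> b = true_at T \<longleftrightarrow> (\<exists>h \<in> hom E T (Dom E m). m \<cdot> h = b))"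
    using assms(1) by (intro classifies_iff) simp_all
  then show ?thesis
    using assms char_simps(4)[OF assms(1)] by blast
qed

definition equality :: "'o \<Rightarrow> 'a" where
  "equality X = char (pair E (Id E X) (Id E X))"

lemma monic_diagonal: "X \<in> Ob E \<Longrightarrow> monic E (pair E (Id E X) (Id E X))"
  by (rule monicI) (auto simp: pair_eq_iff)

lemma equality_simps [simp]:
  assumes "X \<in> Ob E"
  shows "equality X \<in> Ar E" "Dom E (equality X) = Prod E X X" "Cod E (equality X) = Omega E"
  using monic_diagonal[OF assms] assms by (simp_all add: equality_def)

lemma equality_iff:
  assumes "f \<in> hom E T X" "g \<in> hom E T X"
  shows "equality X \<cdot> pair E f g = true_at T \<longleftrightarrow> f = g"
proof -
  have X: "X \<in> Ob E" using assms by auto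
  have "equality X \<cdot> pair E f g = true_at T \<longleftrightarrow> (\<exists>h \<in> hom E T X. pair E (Id E X) (Id E X) \<cdot> h = pair E f g)"
    unfolding equality_def by (subst char_iff[OF monic_diagonal]) (use assms X in simp_all)
  also have "\<dots> \<longleftrightarrow> (\<exists>h \<in> hom E T X. h = f \<and> h = g)"
    by (rule bex_cong[OF HOL.refl]) (use assms X in \<open>auto simp: pair_eq_iff\<close>)
  also have "\<dots> \<longleftrightarrow> f = g" using assms by auto
  finally show ?thesis .
qed

text \<open>A monic map reflects equality at every later stage, so it preserves the truth value of
  an equation and not merely its truth. It will be applied to the transition maps of a
  diagram.\<close>

lemma equality_monic:
  assumes "monic E m" "f \<in> hom E T (Dom E m)" "g \<in> hom E T (Dom E m)"
  shows "equality (Cod E m) \<cdot> pair E (m \<cdot> f) (m \<cdot> g) = equality (Dom E m) \<cdot> pair E f g"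
proof (rule Omega_ext)
  note m = monic_Ar[OF assms(1)]
  have T: "T \<in> Ob E" using assms by auto
  show "equality (Cod E m) \<cdot> pair E (m \<cdot> f) (m \<cdot> g) \<in> hom E T (Omega E)"
    "equality (Dom E m) \<cdot> pair E f g \<in> hom E T (Omega E)"
    using assms m by simp_all
  fix S b assume b: "b \<in> hom E S T"
  have "(equality (Cod E m) \<cdot> pair E (m \<cdot> f) (m \<cdot> g)) \<cdot> b = true_at S \<longleftrightarrow> m \<cdot> (f \<cdot> b) = m \<cdot> (g \<cdot> b)"
    using equality_iff[of "m \<cdot> (f \<cdot> b)" S "Cod E m" "m \<cdot> (g \<cdot> b)"] assms m b by simp
  also have "\<dots> \<longleftrightarrow> f \<cdot> b = g \<cdot> b"
    using monic_cancel[OF assms(1), of "f \<cdot> b" "g \<cdot> b"] assms m b by auto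
  also have "\<dots> \<longleftrightarrow> (equality (Dom E m) \<cdot> pair E f g) \<cdot> b = true_at S"
    using equality_iff[of "f \<cdot> b" S "Dom E m" "g \<cdot> b"] assms m b by simp
  finally show "(equality (Cod E m) \<cdot> pair E (m \<cdot> f) (m \<cdot> g)) \<cdot> b = true_at S \<longleftrightarrow>
    (equality (Dom E m) \<cdot> pair E f g) \<cdot> b = true_at S" .
qed

text \<open>The universal quantifier over \<open>A\<close>: a predicate holds of all arguments
  exactly when its transpose is that of the constantly true one, so \<open>c'\<close> is an equality
  in the power object of \<open>A\<close>.\<close>

lemma forall_ex:
  assumes c: "c \<in> hom E (Prod E B A) (Omega E)" and Ob: "A \<in> Ob E" "B \<in> Ob E"
  obtains c' where "c' \<in> hom E B (Omega E)"
    "\<And>T b. b \<in> hom E T B \<Longrightarrow> c' \<cdot> b = true_at T \<longleftrightarrow> c \<cdot> pair E (b \<cdot> Pr1 E T A) (Pr2 E T A) = true_at (Prod E T A)"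
proof
  define h where "h = transpose E B A (Omega E)"
  have h: "h c \<in> hom E B (Exp E A (Omega E))" "h (true_at (Prod E B A)) \<in> hom E B (Exp E A (Omega E))"
    using c Ob by (simp_all add: h_def)
  let ?c = "equality (Exp E A (Omega E)) \<cdot> pair E (h c) (h (true_at (Prod E B A)))"
  show "?c \<in> hom E B (Omega E)"
    using h Ob by simp
  fix T b assume b: "b \<in> hom E T B"
  then have T: "T \<in> Ob E" by auto
  have "?c \<cdot> b = true_at T \<longleftrightarrow> h c \<cdot> b = h (true_at (Prod E B A)) \<cdot> b"
    using equality_iff[of "h c \<cdot> b" T "Exp E A (Omega E)" "h (true_at (Prod E B A)) \<cdot> b"] h b Ob by simp
  also have "\<dots> \<longleftrightarrow> c \<cdot> pair E (b \<cdot> Pr1 E T A) (Pr2 E T A) = true_at (Prod E B A) \<cdot> pair E (b \<cdot> Pr1 E T A) (Pr2 E T A)"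
    unfolding h_def by (rule transpose_eq_iff[OF _ _ Ob(2,1) b b]) (use c Ob in simp_all)
  also have "true_at (Prod E B A) \<cdot> pair E (b \<cdot> Pr1 E T A) (Pr2 E T A) = true_at (Prod E T A)"
    using b Ob T by simp
  finally show "?c \<cdot> b = true_at T \<longleftrightarrow> c \<cdot> pair E (b \<cdot> Pr1 E T A) (Pr2 E T A) = true_at (Prod E T A)" .
qed

subsection \<open>Images and covers\<close>

text \<open>An extremal epimorphism: it factors through no proper subobject, since a monic map with
  a section is invertible. Minimality of images delivers this form; that such a map is also a
  quotient is the content of \<open>cover_descent\<close>.\<close>

definition cover :: "'a \<Rightarrow> bool" where
  "cover e \<longleftrightarrow> e \<in> Ar E \<and>
     (\<forall>n e'. monic E n \<and> Cod E n = Cod E e \<and> e' \<in> hom E (Dom E e) (Dom E n) \<and> n \<cdot> e' = e \<longrightarrow>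
        (\<exists>k \<in> hom E (Cod E e) (Dom E n). n \<cdot> k = Id E (Cod E e)))"

lemma cover_Ar [simp]: "cover e \<Longrightarrow> e \<in> Ar E"
  by (simp add: cover_def)

text \<open>The image is formed impredicatively, as the intersection of all subobjects through which
  \<open>f\<close> factors. The intersection ranges over an internal family, so it must still be
  compared with each external subobject \<open>v\<close>.\<close>

lemma least_subobject:
  assumes f: "f \<in> hom E W P"
  obtains m e where "monic E m" "Cod E m = P" "e \<in> hom E W (Dom E m)" "m \<cdot> e = f"
    "\<And>v f'. \<lbrakk>monic E v; Cod E v = P; f' \<in> hom E W (Dom E v); v \<cdot> f' = f\<rbrakk> \<Longrightarrow> \<exists>k \<in> hom E (Dom E m) (Dom E v). v \<cdot> k = m"
proof -
  have Ob: "W \<in> Ob E" "P \<in> Ob E" using f by auto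
  let ?K = "Exp E P (Omega E)" and ?app = "apply_exp E P (Omega E)"
  \<comment> \<open>\<open>cN\<close> says of a subset \<open>U\<close> of \<open>P\<close> that it
    contains \<open>f(w)\<close> for all \<open>w\<close>; the object \<open>N\<close> consists of
    these subsets.\<close>
  have "?app (Pr1 E ?K W) (f \<cdot> Pr2 E ?K W) \<in> hom E (Prod E ?K W) (Omega E)"
    using f Ob by simp
  then obtain cN where cN: "cN \<in> hom E ?K (Omega E)" and
    "\<And>T U. U \<in> hom E T ?K \<Longrightarrow> cN \<cdot> U = true_at T \<longleftrightarrow>
      ?app (Pr1 E ?K W) (f \<cdot> Pr2 E ?K W) \<cdot> pair E (U \<cdot> Pr1 E T W) (Pr2 E T W) = true_at (Prod E T W)"
    by (rule forall_ex) (use Ob in auto)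
  then have cN_iff: "cN \<cdot> U = true_at T \<longleftrightarrow> ?app (U \<cdot> Pr1 E T W) (f \<cdot> Pr2 E T W) = true_at (Prod E T W)"
    if "U \<in> hom E T ?K" for T U
    using that f Ob by auto
  obtain n where n: "monic E n" "Cod E n = ?K"
    and n_iff: "\<And>T U. U \<in> hom E T ?K \<Longrightarrow> cN \<cdot> U = true_at T \<longleftrightarrow> (\<exists>h \<in> hom E T (Dom E n). n \<cdot> h = U)"
    using comprehension[OF cN] by metis
  define N where "N = Dom E n"
  have nN: "n \<in> hom E N ?K" "N \<in> Ob E" using n by (simp_all add: N_def)
  \<comment> \<open>\<open>cY\<close> says of \<open>p\<close> that it belongs to every member of
    \<open>N\<close>, so \<open>m\<close> is the intersection of the family.\<close>
  have "?app (n \<cdot> Pr2 E P N) (Pr1 E P N) \<in> hom E (Prod E P N) (Omega E)"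
    using nN Ob by simp
  then obtain cY where cY: "cY \<in> hom E P (Omega E)" and
    "\<And>T p. p \<in> hom E T P \<Longrightarrow> cY \<cdot> p = true_at T \<longleftrightarrow>
      ?app (n \<cdot> Pr2 E P N) (Pr1 E P N) \<cdot> pair E (p \<cdot> Pr1 E T N) (Pr2 E T N) = true_at (Prod E T N)"
    by (rule forall_ex) (use Ob nN in auto)
  then have cY_iff: "cY \<cdot> p = true_at T \<longleftrightarrow> ?app (n \<cdot> Pr2 E T N) (p \<cdot> Pr1 E T N) = true_at (Prod E T N)"
    if "p \<in> hom E T P" for T p
    using that nN Ob by auto
  obtain m where m: "monic E m" "Cod E m = P"
    and m_iff: "\<And>T p. p \<in> hom E T P \<Longrightarrow> cY \<cdot> p = true_at T \<longleftrightarrow> (\<exists>h \<in> hom E T (Dom E m). m \<cdot> h = p)"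
    using comprehension[OF cY] by metis
  have "cN \<cdot> n = true_at N"
    using n_iff[OF nN(1)] nN N_def by (metis Comp_Id(1) Id_simps mem_hom)
  then have "?app (n \<cdot> Pr1 E N W) (f \<cdot> Pr2 E N W) = true_at (Prod E N W)"
    using cN_iff[OF nN(1)] by simp
  \<comment> \<open>Exchanging the factors turns a statement about all \<open>w\<close> for given
    \<open>U\<close> into one about all \<open>U\<close> for given \<open>w\<close>.\<close>
  then have "?app (n \<cdot> Pr1 E N W) (f \<cdot> Pr2 E N W) \<cdot> pair E (Pr2 E W N) (Pr1 E W N) = true_at (Prod E N W) \<cdot> pair E (Pr2 E W N) (Pr1 E W N)"
    by simp
  then have "cY \<cdot> f = true_at W"
    using cY_iff[OF f] nN f Ob by simp
  then obtain e where e: "e \<in> hom E W (Dom E m)" "m \<cdot> e = f"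
    using m_iff[OF f] by blast
  have "\<exists>k \<in> hom E (Dom E m) (Dom E v). v \<cdot> k = m"
    if v: "monic E v" "Cod E v = P" "f' \<in> hom E W (Dom E v)" "v \<cdot> f' = f" for v f'
  proof -
    \<comment> \<open>The name of \<open>v\<close>: the global element of the power object that
      corresponds to this subobject.\<close>
    define U where "U = transpose E (One E) P (Omega E) (char v \<cdot> Pr2 E (One E) P)"
    have U: "U \<in> hom E (One E) ?K"
      using v Ob by (simp add: U_def)
    have U_app: "?app (U \<cdot> bang E T) p = char v \<cdot> p" if "p \<in> hom E T P" for T p
    proof -
      have "T \<in> Ob E" using that by auto
      then show ?thesis using that v Ob by (simp add: U_def)
    qed
    have "char v \<cdot> f = true_at W"
      using char_iff[of v f W] v f by auto
    then have "(char v \<cdot> f) \<cdot> Pr2 E (One E) W = true_at (Prod E (One E) W)"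
      using Ob by simp
    then have "?app (U \<cdot> bang E (Prod E (One E) W)) (f \<cdot> Pr2 E (One E) W) = true_at (Prod E (One E) W)"
      using v f Ob by (subst U_app) simp_all
    moreover have "Pr1 E (One E) W = bang E (Prod E (One E) W)"
      using bang_unique[of "Pr1 E (One E) W"] Ob by simp
    ultimately have "cN \<cdot> U = true_at (One E)"
      using cN_iff[OF U] by simp
    then obtain u where u: "u \<in> hom E (One E) N" "n \<cdot> u = U"
      using n_iff[OF U] N_def by blast
    have mP: "m \<in> hom E (Dom E m) P" "Dom E m \<in> Ob E"
      using m by simp_all
    have "cY \<cdot> m = true_at (Dom E m)"
      using m_iff[OF mP(1)] m mP by (metis Comp_Id(1) Id_simps mem_hom)
    then have "?app (n \<cdot> Pr2 E (Dom E m) N) (m \<cdot> Pr1 E (Dom E m) N) = true_at (Prod E (Dom E m) N)"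
      using cY_iff[OF mP(1)] by simp
    \<comment> \<open>Specialise the quantified member of \<open>N\<close> to the name of
      \<open>v\<close>.\<close>
    then have "?app (n \<cdot> Pr2 E (Dom E m) N) (m \<cdot> Pr1 E (Dom E m) N) \<cdot> pair E (Id E (Dom E m)) (u \<cdot> bang E (Dom E m)) =
      true_at (Prod E (Dom E m) N) \<cdot> pair E (Id E (Dom E m)) (u \<cdot> bang E (Dom E m))"
      by simp
    then have "?app (n \<cdot> (u \<cdot> bang E (Dom E m))) m = true_at (Dom E m)"
      using mP nN u Ob by simp
    moreover have "n \<cdot> (u \<cdot> bang E (Dom E m)) = U \<cdot> bang E (Dom E m)"
      using mP nN u(1) by (simp flip: u(2))
    ultimately have "char v \<cdot> m = true_at (Dom E m)"
      using U_app[OF mP(1)] by simp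
    then show ?thesis
      using char_iff[of v m "Dom E m"] v mP m by auto
  qed
  then show ?thesis
    using that m e by blast
qed

text \<open>If \<open>e\<close> factors through \<open>n\<close>, then \<open>f\<close> factors
  through the subobject \<open>m \<cdot> n\<close>, and minimality of \<open>m\<close> provides a
  section of \<open>n\<close>.\<close>

lemma image_factorization:
  assumes f: "f \<in> hom E W P"
  obtains m e where "monic E m" "Cod E m = P" "cover e" "e \<in> hom E W (Dom E m)" "m \<cdot> e = f"
proof -
  obtain m e where m: "monic E m" "Cod E m = P" and e: "e \<in> hom E W (Dom E m)" "m \<cdot> e = f"
    and least: "\<And>v f'. \<lbrakk>monic E v; Cod E v = P; f' \<in> hom E W (Dom E v); v \<cdot> f' = f\<rbrakk> \<Longrightarrow> \<exists>k \<in> hom E (Dom E m) (Dom E v). v \<cdot> k = m"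
    using least_subobject[OF f] by metis
  have "cover e"
    unfolding cover_def
  proof (intro HOL.conjI allI impI)
    fix n e' assume "monic E n \<and> Cod E n = Cod E e \<and> e' \<in> hom E (Dom E e) (Dom E n) \<and> n \<cdot> e' = e"
    then have n: "monic E n" "Cod E n = Dom E m" "e' \<in> hom E W (Dom E n)" "n \<cdot> e' = e"
      using e by auto
    have mn: "monic E (m \<cdot> n)"
      using monic_Comp[of n m] m n by simp
    have "(m \<cdot> n) \<cdot> e' = m \<cdot> (n \<cdot> e')"
      using m(1) n(1-3) by simp
    then have "(m \<cdot> n) \<cdot> e' = f"
      using n(4) e(2) by simp
    then have "\<exists>k \<in> hom E (Dom E m) (Dom E (m \<cdot> n)). (m \<cdot> n) \<cdot> k = m"
      by (intro least[OF mn, of e']) (use m(1,2) n(1-3) in simp_all)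
    then obtain k where k: "k \<in> hom E (Dom E m) (Dom E n)" "m \<cdot> (n \<cdot> k) = m"
      using m n by auto
    have "n \<cdot> k = Id E (Dom E m)"
      by (rule monic_cancel[OF m(1)]) (use k m n in simp_all)
    then show "\<exists>k\<in>hom E (Cod E e) (Dom E n). n \<cdot> k = Id E (Cod E e)"
      using k e by auto
  qed (use e in simp)
  then show ?thesis
    using that m e by blast
qed

text \<open>The pullback of \<open>z\<close> along \<open>y\<close> is a subobject through which
  \<open>e\<close> factors, so it has a section \<open>k\<close>; the diagonal is
  \<open>q \<cdot> k\<close>.\<close>

lemma cover_orthogonal:
  assumes e: "cover e" and z: "monic E z"
    and y: "y \<in> hom E (Cod E e) (Cod E z)" and c: "c \<in> hom E (Dom E e) (Dom E z)"
    and eq: "y \<cdot> e = z \<cdot> c"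
  obtains d where "d \<in> hom E (Cod E e) (Dom E z)" "z \<cdot> d = y"
proof -
  obtain p q where pb: "is_pullback E y z p q"
    using pullback_ex[of y z] y z by auto
  note p = pullbackD[OF pb]
  have pm: "monic E p"
    using pullback_monic[OF pb z] .
  obtain e' where e': "e' \<in> hom E (Dom E e) (Dom E p)" "p \<cdot> e' = e"
    using pullback_ex1[OF pb _ _ eq] e y c by (metis cover_Ar mem_hom)
  then obtain k where k: "k \<in> hom E (Cod E e) (Dom E p)" "p \<cdot> k = Id E (Cod E e)"
    using e pm p y unfolding cover_def by (metis mem_hom)
  have "z \<cdot> (q \<cdot> k) = y \<cdot> (p \<cdot> k)"
    using p k(1) y Comp_assoc[of k q z] Comp_assoc[of k p y] by simp
  then have "z \<cdot> (q \<cdot> k) = y"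
    using k y by simp
  moreover have "q \<cdot> k \<in> hom E (Cod E e) (Dom E z)"
    using k p by simp
  ultimately show ?thesis
    using that by blast
qed

text \<open>The transpose of equality is the map \<open>x \<mapsto> {x}\<close>. If the singletons
  of \<open>f\<close> and \<open>g\<close> agree, then \<open>f\<close> lies in the singleton of
  \<open>g\<close>.\<close>

lemma monic_singleton:
  assumes X: "X \<in> Ob E"
  shows "monic E (transpose E X X (Omega E) (equality X))" (is "monic E ?s")
proof (rule monicI)
  show "?s \<in> Ar E" using X by simp
  fix f g
  assume *: "f \<in> Ar E" "g \<in> Ar E" "Dom E f = Dom E g" "Cod E f = Dom E ?s" "Cod E g = Dom E ?s" "?s \<cdot> f = ?s \<cdot> g"
  let ?T = "Dom E g"
  have fg: "f \<in> hom E ?T X" "g \<in> hom E ?T X" using * X by simp_all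
  have "apply_exp E X (Omega E) (?s \<cdot> f) f = apply_exp E X (Omega E) (?s \<cdot> g) f"
    using * by simp
  then have "equality X \<cdot> pair E f f = equality X \<cdot> pair E g f"
    using fg X by simp
  then show "f = g"
    using equality_iff[OF fg(1,1)] equality_iff[OF fg(2,1)] by metis
qed

text \<open>The extension \<open>t\<close> is found through its graph, the subobject of all \<open>(i, x)\<close> such that
  \<open>e w = i\<close> is equivalent to \<open>e w = i \<and> k w = x\<close> for all \<open>w\<close>.\<close>

lemma cover_descent:
  assumes e: "cover e" "e \<in> hom E W I" and k: "k \<in> hom E W X"
    and ker: "\<And>T a b. \<lbrakk>a \<in> hom E T W; b \<in> hom E T W; e \<cdot> a = e \<cdot> b\<rbrakk> \<Longrightarrow> k \<cdot> a = k \<cdot> b"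
  obtains t where "t \<in> hom E I X" "t \<cdot> e = k"
proof -
  have Ob [simp]: "W \<in> Ob E" "I \<in> Ob E" "X \<in> Ob E" using e k by auto
  let ?B = "Prod E I X" and ?I = "Pr1 E I X" and ?X = "Pr2 E I X" and ?s = "transpose E X X (Omega E) (equality X)"
  \<comment> \<open>\<open>\<phi>\<close> is \<open>e w = i\<close>, and \<open>\<psi>\<close> adds
    \<open>k w = x\<close>. Equality of the two predicates in \<open>w\<close> expresses that the
    first condition implies the second, with no implication on \<Omega> to be defined.\<close>
  define \<phi> where "\<phi> = equality I \<cdot> pair E (e \<cdot> Pr2 E ?B W) (?I \<cdot> Pr1 E ?B W)"
  define \<psi> where "\<psi> = equality ?B \<cdot> pair E (pair E (e \<cdot> Pr2 E ?B W) (k \<cdot> Pr2 E ?B W)) (Pr1 E ?B W)"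
  have \<phi>\<psi>: "\<phi> \<in> hom E (Prod E ?B W) (Omega E)" "\<psi> \<in> hom E (Prod E ?B W) (Omega E)"
    using e k by (simp_all add: \<phi>_def \<psi>_def)
  have \<phi>_iff: "\<phi> \<cdot> pair E (pair E i x) w = true_at T \<longleftrightarrow> e \<cdot> w = i"
    if "i \<in> hom E T I" "x \<in> hom E T X" "w \<in> hom E T W" for T i x w
    using that e equality_iff[of "e \<cdot> w" T I i] by (simp add: \<phi>_def)
  have \<psi>_iff: "\<psi> \<cdot> pair E (pair E i x) w = true_at T \<longleftrightarrow> e \<cdot> w = i \<and> k \<cdot> w = x"
    if "i \<in> hom E T I" "x \<in> hom E T X" "w \<in> hom E T W" for T i x w
    using that e k equality_iff[of "pair E (e \<cdot> w) (k \<cdot> w)" T ?B "pair E i x"] by (simp add: \<psi>_def pair_eq_iff)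
  define tr where "tr = transpose E ?B W (Omega E)"
  have tr: "tr \<phi> \<in> hom E ?B (Exp E W (Omega E))" "tr \<psi> \<in> hom E ?B (Exp E W (Omega E))"
    using \<phi>\<psi> by (simp_all add: tr_def)
  define R where "R = equality (Exp E W (Omega E)) \<cdot> pair E (tr \<phi>) (tr \<psi>)"
  have R: "R \<in> hom E ?B (Omega E)" using tr by (simp add: R_def)
  \<comment> \<open>At a point \<open>e \<cdot> w\<close> the relation has the single value
    \<open>k \<cdot> w\<close>: one direction tests it at \<open>w\<close> itself, the other is
    \<open>ker\<close>.\<close>
  have R_iff: "R \<cdot> pair E (e \<cdot> w) x = true_at T \<longleftrightarrow> k \<cdot> w = x" if w: "w \<in> hom E T W" "x \<in> hom E T X" for T w x
  proof -
    have T [simp]: "T \<in> Ob E" using w by auto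
    let ?P = "Prod E T W"
    let ?p = "pair E (pair E (e \<cdot> (w \<cdot> Pr1 E T W)) (x \<cdot> Pr1 E T W)) (Pr2 E T W)"
    have b: "pair E (e \<cdot> w) x \<in> hom E T ?B"
      using w e by simp
    have "R \<cdot> pair E (e \<cdot> w) x = true_at T \<longleftrightarrow> tr \<phi> \<cdot> pair E (e \<cdot> w) x = tr \<psi> \<cdot> pair E (e \<cdot> w) x"
      using equality_iff[of "tr \<phi> \<cdot> pair E (e \<cdot> w) x" T "Exp E W (Omega E)" "tr \<psi> \<cdot> pair E (e \<cdot> w) x"] tr b
      by (simp add: R_def)
    also have "\<dots> \<longleftrightarrow> \<phi> \<cdot> ?p = \<psi> \<cdot> ?p"
      unfolding tr_def by (subst transpose_eq_iff[OF \<phi>\<psi> _ _ b b]) (use w e in simp_all)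
    also have "\<dots> \<longleftrightarrow> k \<cdot> w = x"
    proof
      assume "\<phi> \<cdot> ?p = \<psi> \<cdot> ?p"
      then have "(\<phi> \<cdot> ?p) \<cdot> pair E (Id E T) w = (\<psi> \<cdot> ?p) \<cdot> pair E (Id E T) w"
        by simp
      then have "\<phi> \<cdot> pair E (pair E (e \<cdot> w) x) w = \<psi> \<cdot> pair E (pair E (e \<cdot> w) x) w"
        using w e \<phi>\<psi> by simp
      then show "k \<cdot> w = x"
        using \<phi>_iff[of "e \<cdot> w" T x w] \<psi>_iff[of "e \<cdot> w" T x w] w e by simp
    next
      assume kw: "k \<cdot> w = x"
      show "\<phi> \<cdot> ?p = \<psi> \<cdot> ?p"
      proof (rule Omega_ext[of _ ?P])
        show "\<phi> \<cdot> ?p \<in> hom E ?P (Omega E)" "\<psi> \<cdot> ?p \<in> hom E ?P (Omega E)"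
          using w e \<phi>\<psi> by simp_all
        fix S b assume b: "b \<in> hom E S ?P"
        define t where "t = Pr1 E T W \<cdot> b"
        define v where "v = Pr2 E T W \<cdot> b"
        have t: "t \<in> hom E S T" and v: "v \<in> hom E S W"
          using b by (simp_all add: t_def v_def)
        have "?p \<cdot> b = pair E (pair E (e \<cdot> (w \<cdot> t)) (x \<cdot> t)) v"
          using b w e by (simp add: t_def v_def)
        then have "(\<phi> \<cdot> ?p) \<cdot> b = \<phi> \<cdot> pair E (pair E (e \<cdot> (w \<cdot> t)) (x \<cdot> t)) v"
          "(\<psi> \<cdot> ?p) \<cdot> b = \<psi> \<cdot> pair E (pair E (e \<cdot> (w \<cdot> t)) (x \<cdot> t)) v"
          using b w e \<phi>\<psi> by simp_all
        moreover have "k \<cdot> v = x \<cdot> t" if "e \<cdot> v = e \<cdot> (w \<cdot> t)"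
          using ker[of v S "w \<cdot> t"] that v w t k by (simp flip: kw)
        ultimately show "(\<phi> \<cdot> ?p) \<cdot> b = true_at S \<longleftrightarrow> (\<psi> \<cdot> ?p) \<cdot> b = true_at S"
          using \<phi>_iff[of "e \<cdot> (w \<cdot> t)" S "x \<cdot> t" v] \<psi>_iff[of "e \<cdot> (w \<cdot> t)" S "x \<cdot> t" v] v w t e by auto
      qed
    qed
    finally show ?thesis .
  qed
  \<comment> \<open>\<open>\<theta>\<close> sends \<open>i\<close> to the set of all
    \<open>x\<close> related to it. After \<open>e\<close> these sets are singletons, and
    orthogonality of \<open>e\<close> to the singleton map makes them so on all of
    \<open>I\<close>.\<close>
  define \<theta> where "\<theta> = transpose E I X (Omega E) R"
  have \<theta>: "\<theta> \<in> hom E I (Exp E X (Omega E))"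
    using R by (simp add: \<theta>_def)
  have s: "monic E ?s" "Dom E ?s = X" "Cod E ?s = Exp E X (Omega E)"
    using monic_singleton[of X] by simp_all
  have se: "\<theta> \<cdot> e = ?s \<cdot> k"
  proof (rule Exp_ext_elements[of _ W X "Omega E"])
    show "\<theta> \<cdot> e \<in> hom E W (Exp E X (Omega E))" "?s \<cdot> k \<in> hom E W (Exp E X (Omega E))"
      using \<theta> e k by simp_all
    fix T w x assume w: "w \<in> hom E T W" "x \<in> hom E T X"
    have "R \<cdot> pair E (e \<cdot> w) x = equality X \<cdot> pair E (k \<cdot> w) x"
    proof (rule Omega_ext[of _ T])
      show "R \<cdot> pair E (e \<cdot> w) x \<in> hom E T (Omega E)" "equality X \<cdot> pair E (k \<cdot> w) x \<in> hom E T (Omega E)"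
        using R w e k by simp_all
      fix S b assume b: "b \<in> hom E S T"
      show "(R \<cdot> pair E (e \<cdot> w) x) \<cdot> b = true_at S \<longleftrightarrow> (equality X \<cdot> pair E (k \<cdot> w) x) \<cdot> b = true_at S"
        using R_iff[of "w \<cdot> b" S "x \<cdot> b"] equality_iff[of "k \<cdot> (w \<cdot> b)" S X "x \<cdot> b"] b w R e k by simp
    qed
    then show "apply_exp E X (Omega E) ((\<theta> \<cdot> e) \<cdot> w) x = apply_exp E X (Omega E) ((?s \<cdot> k) \<cdot> w) x"
      using R w e k \<theta> by (simp add: \<theta>_def)
  qed simp_all
  obtain t where t: "t \<in> hom E I X" "?s \<cdot> t = \<theta>"
    using cover_orthogonal[OF e(1) s(1), of \<theta> k] \<theta> e k s se by (metis mem_hom)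
  have "?s \<cdot> (t \<cdot> e) = (?s \<cdot> t) \<cdot> e"
    using t(1) e s Comp_assoc[of e t ?s] by simp
  then have "?s \<cdot> (t \<cdot> e) = ?s \<cdot> k"
    using se t by simp
  then have "t \<cdot> e = k"
    by (rule monic_cancel[OF s(1), rotated -1]) (use t(1) e k s in simp_all)
  then show ?thesis
    using that t by blast
qed

section \<open>Coequalisers, their products with a fixed object, and kernel pairs\<close>

lemma coequaliserD:
  assumes "is_coequaliser E k l q"
  shows "k \<in> Ar E" "l \<in> Ar E" "q \<in> Ar E" "Dom E l = Dom E k" "Cod E l = Cod E k" "Dom E q = Cod E k" "q \<cdot> k = q \<cdot> l"
  using assms unfolding is_coequaliser_def by simp_all

lemma coequaliser_ex1:
  assumes "is_coequaliser E k l q" "f \<in> hom E (Cod E k) X" "f \<cdot> k = f \<cdot> l"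
  shows "\<exists>!h. h \<in> hom E (Cod E q) X \<and> h \<cdot> q = f"
proof -
  have "X \<in> Ob E" using assms(2) by auto
  then show ?thesis
    using assms unfolding is_coequaliser_def by blast
qed

lemma coequaliser_cancel:
  assumes co: "is_coequaliser E k l q" and h: "h \<in> hom E (Cod E q) X" "h' \<in> hom E (Cod E q) X" and eq: "h \<cdot> q = h' \<cdot> q"
  shows "h = h'"
proof -
  note c = coequaliserD[OF co]
  have "(h \<cdot> q) \<cdot> k = (h \<cdot> q) \<cdot> l"
    using c h by simp
  moreover have "h \<cdot> q \<in> hom E (Cod E k) X"
    using c h by simp
  ultimately have "\<exists>!x. x \<in> hom E (Cod E q) X \<and> x \<cdot> q = h \<cdot> q"
    by (intro coequaliser_ex1[OF co])
  then show ?thesis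
    using h eq by metis
qed

text \<open>A product with \<open>A\<close> has a right adjoint and so preserves the coequaliser:
  transpose, factor through \<open>q\<close>, transpose back. This defines maps on classes in the
  presence of a parameter.\<close>

lemma coequaliser_Prod:
  assumes co: "is_coequaliser E k l q" and A: "A \<in> Ob E" and \<phi>: "\<phi> \<in> hom E (Prod E (Cod E k) A) X"
    and eq: "\<phi> \<cdot> pair E (k \<cdot> Pr1 E (Dom E k) A) (Pr2 E (Dom E k) A) = \<phi> \<cdot> pair E (l \<cdot> Pr1 E (Dom E k) A) (Pr2 E (Dom E k) A)"
  obtains \<phi>' where "\<phi>' \<in> hom E (Prod E (Cod E q) A) X"
    "\<And>T v a. v \<in> hom E T (Cod E k) \<Longrightarrow> a \<in> hom E T A \<Longrightarrow> \<phi>' \<cdot> pair E (q \<cdot> v) a = \<phi> \<cdot> pair E v a"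
proof -
  note c = coequaliserD[OF co]
  have Ob: "Cod E k \<in> Ob E" "Cod E q \<in> Ob E" using c by simp_all
  have X: "X \<in> Ob E" using \<phi> by auto
  define \<theta> where "\<theta> = transpose E (Cod E k) A X \<phi>"
  have \<theta>: "\<theta> \<in> hom E (Cod E k) (Exp E A X)" using \<phi> A Ob by (simp add: \<theta>_def)
  have "\<theta> \<cdot> k = \<theta> \<cdot> l"
    unfolding \<theta>_def by (subst transpose_eq_iff[OF \<phi> \<phi> Ob(1) A, of k "Dom E k" l]) (use c eq in simp_all)
  then obtain \<theta>' where \<theta>': "\<theta>' \<in> hom E (Cod E q) (Exp E A X)" "\<theta>' \<cdot> q = \<theta>"
    using coequaliser_ex1[OF co \<theta>] by blast
  show ?thesis
  proof
    let ?\<phi> = "apply_exp E A X (\<theta>' \<cdot> Pr1 E (Cod E q) A) (Pr2 E (Cod E q) A)"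
    show "?\<phi> \<in> hom E (Prod E (Cod E q) A) X"
      using \<theta>'(1) Ob X A by simp
    fix T v a assume v: "v \<in> hom E T (Cod E k)" "a \<in> hom E T A"
    have "\<theta>' \<cdot> (q \<cdot> v) = \<theta> \<cdot> v"
      using v \<theta>'(1) c by (simp flip: \<theta>'(2))
    then have "?\<phi> \<cdot> pair E (q \<cdot> v) a = apply_exp E A X (\<theta> \<cdot> v) a"
      using v \<theta>'(1) c Ob X A by simp
    also have "\<dots> = \<phi> \<cdot> pair E v a"
      using v \<phi> A Ob by (simp add: \<theta>_def)
    finally show "?\<phi> \<cdot> pair E (q \<cdot> v) a = \<phi> \<cdot> pair E v a" .
  qed
qed

text \<open>\<open>q\<close> stays epic after a product with \<open>A\<close>, again by
  transposition, so laws checked on classes \<open>q \<cdot> v\<close> hold for all elements of the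
  quotient.\<close>

lemma coequaliser_Prod_cancel:
  assumes co: "is_coequaliser E k l q" and A: "A \<in> Ob E"
    and \<alpha>: "\<alpha> \<in> hom E (Prod E (Cod E q) A) X" "\<beta> \<in> hom E (Prod E (Cod E q) A) X"
    and eq: "\<And>T v a. \<lbrakk>v \<in> hom E T (Cod E k); a \<in> hom E T A\<rbrakk> \<Longrightarrow> \<alpha> \<cdot> pair E (q \<cdot> v) a = \<beta> \<cdot> pair E (q \<cdot> v) a"
  shows "\<alpha> = \<beta>"
proof -
  note c = coequaliserD[OF co]
  have Ob: "Cod E k \<in> Ob E" "Cod E q \<in> Ob E" using c by simp_all
  let ?tr = "transpose E (Cod E q) A X"
  have "?tr \<alpha> \<cdot> q = ?tr \<beta> \<cdot> q"
  proof (subst transpose_eq_iff[OF \<alpha> Ob(2) A, of q "Cod E k" q])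
    show "\<alpha> \<cdot> pair E (q \<cdot> Pr1 E (Cod E k) A) (Pr2 E (Cod E k) A) = \<beta> \<cdot> pair E (q \<cdot> Pr1 E (Cod E k) A) (Pr2 E (Cod E k) A)"
      using Ob A by (intro eq) simp_all
  qed (use c in simp_all)
  then have "?tr \<alpha> = ?tr \<beta>"
    by (rule coequaliser_cancel[OF co, rotated -1]) (use \<alpha> Ob A in simp_all)
  then have "apply_exp E A X (?tr \<alpha> \<cdot> Pr1 E (Cod E q) A) (Pr2 E (Cod E q) A) = apply_exp E A X (?tr \<beta> \<cdot> Pr1 E (Cod E q) A) (Pr2 E (Cod E q) A)"
    by simp
  then show ?thesis
    using \<alpha> Ob A by simp
qed

text \<open>Since \<open>m\<close> is monic, \<open>e\<close> and \<open>f\<close> identify the same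
  elements. Hence \<open>e\<close> induces a map \<open>j\<close> on the quotient, and descent of
  \<open>q\<close> along \<open>e\<close> gives a retraction of \<open>j\<close>.\<close>

lemma kernel_pair_quotient_monic:
  assumes f: "f \<in> hom E W P" "is_kernel_pair E f k l" and co: "is_coequaliser E k l q"
    and e: "cover e" "e \<in> hom E W (Dom E m)" and m: "monic E m" "m \<cdot> e = f"
  obtains j where "monic E j" "j \<in> hom E (Cod E q) (Dom E m)"
proof -
  note c = coequaliserD[OF co]
  have pb: "is_pullback E f f k l" using f(2) by (simp add: is_kernel_pair_def)
  note p = pullbackD[OF pb]
  have "m \<cdot> (e \<cdot> k) = (m \<cdot> e) \<cdot> k" "m \<cdot> (e \<cdot> l) = (m \<cdot> e) \<cdot> l"
    using e m(1) f(1) p by simp_all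
  then have "m \<cdot> (e \<cdot> k) = m \<cdot> (e \<cdot> l)"
    using m(2) p(9) by simp
  then have "e \<cdot> k = e \<cdot> l"
    by (rule monic_cancel[OF m(1), rotated -1]) (use e f(1) p in simp_all)
  then obtain j where j: "j \<in> hom E (Cod E q) (Dom E m)" "j \<cdot> q = e"
    using coequaliser_ex1[OF co, of e "Dom E m"] e f(1) p by auto
  have q: "q \<in> hom E W (Cod E q)" using c f(1) p by simp
  have "q \<cdot> a = q \<cdot> b" if ab: "a \<in> hom E T W" "b \<in> hom E T W" "e \<cdot> a = e \<cdot> b" for T a b
  proof -
    have "(m \<cdot> e) \<cdot> a = (m \<cdot> e) \<cdot> b"
      using ab e m(1) by simp
    then obtain h where h: "h \<in> hom E T (Dom E k)" "k \<cdot> h = a" "l \<cdot> h = b"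
      using pullback_ex1[OF pb, of a T b] ab f(1) m(2) by auto
    have "q \<cdot> (k \<cdot> h) = q \<cdot> (l \<cdot> h)"
      using c h(1) Comp_assoc[of h k q] Comp_assoc[of h l q] by simp
    then show ?thesis using h by simp
  qed
  then obtain t where t: "t \<in> hom E (Dom E m) (Cod E q)" "t \<cdot> e = q"
    using cover_descent[OF e q] by metis
  have "(t \<cdot> j) \<cdot> q = Id E (Cod E q) \<cdot> q"
    using t j c by simp
  then have "t \<cdot> j = Id E (Cod E q)"
    by (rule coequaliser_cancel[OF co, rotated -1]) (use t(1) j(1) c in simp_all)
  moreover have "monic E (Id E (Cod E q))"
    using monic_Id c by simp
  ultimately have "monic E j"
    using monic_of_Comp[of t j] t(1) j(1) by simp
  then show ?thesis using that j(1) by blast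
qed

text \<open>View \<open>g\<close> as a relation between \<open>Dom E s\<close> and \<open>W\<close>,
  push it forward along \<open>s\<close>, and classify the result. Restriction recovers the relation
  because \<open>s\<close> is monic.\<close>

lemma Exp_Omega_injective:
  assumes s: "monic E s" and g: "g \<in> hom E (Dom E s) (Exp E W (Omega E))" and W: "W \<in> Ob E"
  obtains g' where "g' \<in> hom E (Cod E s) (Exp E W (Omega E))" "g' \<cdot> s = g"
proof -
  let ?S = "Dom E s" and ?C = "Cod E s"
  have Ob: "?S \<in> Ob E" "?C \<in> Ob E" "s \<in> Ar E" using s by simp_all
  let ?c = "apply_exp E W (Omega E) (g \<cdot> Pr1 E ?S W) (Pr2 E ?S W)"
  have c: "?c \<in> hom E (Prod E ?S W) (Omega E)"
    using g Ob W by simp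
  obtain n where n: "monic E n" "Cod E n = Prod E ?S W"
    and n_iff: "\<And>T b. b \<in> hom E T (Prod E ?S W) \<Longrightarrow> ?c \<cdot> b = true_at T \<longleftrightarrow> (\<exists>h \<in> hom E T (Dom E n). n \<cdot> h = b)"
    using comprehension[OF c] by metis
  define sw where "sw = pair E (s \<cdot> Pr1 E ?S W) (Pr2 E ?S W)"
  have sw: "sw \<in> hom E (Prod E ?S W) (Prod E ?C W)"
    using Ob W by (simp add: sw_def)
  have swm: "monic E sw"
  proof (rule monicI)
    fix a b
    assume *: "a \<in> Ar E" "b \<in> Ar E" "Dom E a = Dom E b" "Cod E a = Dom E sw" "Cod E b = Dom E sw" "sw \<cdot> a = sw \<cdot> b"
    then have "pair E (s \<cdot> (Pr1 E ?S W \<cdot> a)) (Pr2 E ?S W \<cdot> a) = pair E (s \<cdot> (Pr1 E ?S W \<cdot> b)) (Pr2 E ?S W \<cdot> b)"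
      using Ob W sw by (simp add: sw_def)
    then have ab: "s \<cdot> (Pr1 E ?S W \<cdot> a) = s \<cdot> (Pr1 E ?S W \<cdot> b)" "Pr2 E ?S W \<cdot> a = Pr2 E ?S W \<cdot> b"
      using Ob W * sw by (simp_all add: pair_eq_iff)
    have "Pr1 E ?S W \<cdot> a = Pr1 E ?S W \<cdot> b"
      by (rule monic_cancel[OF s _ _ _ _ ab(1)]) (use Ob W * sw in simp_all)
    then show "a = b"
      by (rule Prod_ext[rotated -2, OF _ ab(2)]) (use Ob W * sw in simp_all)
  qed (use sw in simp)
  have v: "monic E (sw \<cdot> n)" "Cod E (sw \<cdot> n) = Prod E ?C W"
    using monic_Comp[OF n(1) swm] sw n by simp_all
  \<comment> \<open>Direct image followed by inverse image along a monic map is the identity on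
    subobjects.\<close>
  have eq: "char (sw \<cdot> n) \<cdot> sw = ?c"
  proof (rule Omega_ext[OF _ c])
    show "char (sw \<cdot> n) \<cdot> sw \<in> hom E (Prod E ?S W) (Omega E)"
      using v sw by simp
    fix T b assume b: "b \<in> hom E T (Prod E ?S W)"
    have "(char (sw \<cdot> n) \<cdot> sw) \<cdot> b = char (sw \<cdot> n) \<cdot> (sw \<cdot> b)"
      using v sw b by simp
    also have "\<dots> = true_at T \<longleftrightarrow> (\<exists>h \<in> hom E T (Dom E n). (sw \<cdot> n) \<cdot> h = sw \<cdot> b)"
      using char_iff[OF v(1), of "sw \<cdot> b" T] v sw b n by simp
    also have "\<dots> \<longleftrightarrow> (\<exists>h \<in> hom E T (Dom E n). n \<cdot> h = b)"
    proof (rule bex_cong[OF HOL.refl])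
      fix h assume h: "h \<in> hom E T (Dom E n)"
      show "(sw \<cdot> n) \<cdot> h = sw \<cdot> b \<longleftrightarrow> n \<cdot> h = b"
        using monic_cancel[OF swm, of "n \<cdot> h" b] h n sw b by auto
    qed
    also have "\<dots> \<longleftrightarrow> ?c \<cdot> b = true_at T"
      using n_iff[OF b] by simp
    finally show "(char (sw \<cdot> n) \<cdot> sw) \<cdot> b = true_at T \<longleftrightarrow> ?c \<cdot> b = true_at T" .
  qed
  let ?g = "transpose E ?C W (Omega E) (char (sw \<cdot> n))"
  have g': "?g \<in> hom E ?C (Exp E W (Omega E))"
    using v Ob W by simp
  have "?g \<cdot> s = g"
  proof (rule Exp_ext[of _ ?S W "Omega E"])
    show "apply_exp E W (Omega E) ((?g \<cdot> s) \<cdot> Pr1 E ?S W) (Pr2 E ?S W) = ?c"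
      using v Ob W eq by (simp add: sw_def)
  qed (use g' g Ob W in simp_all)
  then show ?thesis using that g' by blast
qed

end

section \<open>Filtered colimits and compactness\<close>

lemma category_Comp_hom:
  "is_category J \<Longrightarrow> u \<in> hom J i j \<Longrightarrow> v \<in> hom J j k \<Longrightarrow> v \<cdot>\<^bsub>J\<^esub> u \<in> hom J i k"
  unfolding is_category_def hom_def by blast

lemma category_Comp_assoc:
  "\<lbrakk>is_category J; u \<in> hom J i j; v \<in> hom J j k; w \<in> hom J k l\<rbrakk> \<Longrightarrow> (w \<cdot>\<^bsub>J\<^esub> v) \<cdot>\<^bsub>J\<^esub> u = w \<cdot>\<^bsub>J\<^esub> (v \<cdot>\<^bsub>J\<^esub> u)"
  unfolding is_category_def hom_def by blast

lemma filtered_upper_bound: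
  assumes "is_filtered J" "i \<in> Ob J" "j \<in> Ob J"
  obtains k u v where "u \<in> hom J i k" "v \<in> hom J j k"
  using assms unfolding is_filtered_def by blast

lemma filtered_coequalise:
  assumes "is_filtered J" "u \<in> hom J i j" "v \<in> hom J i j"
  obtains k w where "w \<in> hom J j k" "w \<cdot>\<^bsub>J\<^esub> u = w \<cdot>\<^bsub>J\<^esub> v"
proof -
  have "\<exists>w\<in>Ar J. Dom J w = Cod J u \<and> w \<cdot>\<^bsub>J\<^esub> u = w \<cdot>\<^bsub>J\<^esub> v"
    using assms unfolding is_filtered_def hom_def by fastforce
  then show ?thesis
    using that assms(2) by (auto simp: hom_def)
qed

text \<open>Two parallel pairs arise over a common upper bound, one from \<open>i\<close> and one
  from \<open>j\<close>. The second is coequalised after the first, which keeps the first equation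
  valid.\<close>

lemma filtered_span:
  assumes cat: "is_category J" and fil: "is_filtered J"
    and uv: "u \<in> hom J i k" "v \<in> hom J j k" "u' \<in> hom J i k'" "v' \<in> hom J j k'" and k: "k \<in> Ob J" "k' \<in> Ob J"
  obtains l w w' where "w \<in> hom J k l" "w' \<in> hom J k' l" "w \<cdot>\<^bsub>J\<^esub> u = w' \<cdot>\<^bsub>J\<^esub> u'" "w \<cdot>\<^bsub>J\<^esub> v = w' \<cdot>\<^bsub>J\<^esub> v'"
proof -
  obtain l0 a a' where a: "a \<in> hom J k l0" "a' \<in> hom J k' l0"
    using filtered_upper_bound[OF fil k] .
  note C = category_Comp_hom[OF cat] and A = category_Comp_assoc[OF cat]
  obtain l1 b where b: "b \<in> hom J l0 l1" "b \<cdot>\<^bsub>J\<^esub> (a \<cdot>\<^bsub>J\<^esub> u) = b \<cdot>\<^bsub>J\<^esub> (a' \<cdot>\<^bsub>J\<^esub> u')"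
    using filtered_coequalise[OF fil C[OF uv(1) a(1)] C[OF uv(3) a(2)]] .
  obtain l c where c: "c \<in> hom J l1 l"
    "c \<cdot>\<^bsub>J\<^esub> (b \<cdot>\<^bsub>J\<^esub> (a \<cdot>\<^bsub>J\<^esub> v)) = c \<cdot>\<^bsub>J\<^esub> (b \<cdot>\<^bsub>J\<^esub> (a' \<cdot>\<^bsub>J\<^esub> v'))"
    using filtered_coequalise[OF fil C[OF C[OF uv(2) a(1)] b(1)] C[OF C[OF uv(4) a(2)] b(1)]] .
  have w: "(c \<cdot>\<^bsub>J\<^esub> (b \<cdot>\<^bsub>J\<^esub> x)) \<cdot>\<^bsub>J\<^esub> y = c \<cdot>\<^bsub>J\<^esub> (b \<cdot>\<^bsub>J\<^esub> (x \<cdot>\<^bsub>J\<^esub> y))" if "x \<in> hom J m l0" "y \<in> hom J n m" for m n x y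
    using A[OF that(2) C[OF that(1) b(1)] c(1)] A[OF that(2,1) b(1)] by simp
  show ?thesis
  proof
    show "c \<cdot>\<^bsub>J\<^esub> (b \<cdot>\<^bsub>J\<^esub> a) \<in> hom J k l" "c \<cdot>\<^bsub>J\<^esub> (b \<cdot>\<^bsub>J\<^esub> a') \<in> hom J k' l"
      using C a b(1) c(1) by blast+
    show "(c \<cdot>\<^bsub>J\<^esub> (b \<cdot>\<^bsub>J\<^esub> a)) \<cdot>\<^bsub>J\<^esub> u = (c \<cdot>\<^bsub>J\<^esub> (b \<cdot>\<^bsub>J\<^esub> a')) \<cdot>\<^bsub>J\<^esub> u'"
      using w[OF a(1) uv(1)] w[OF a(2) uv(3)] b(2) by simp
    show "(c \<cdot>\<^bsub>J\<^esub> (b \<cdot>\<^bsub>J\<^esub> a)) \<cdot>\<^bsub>J\<^esub> v = (c \<cdot>\<^bsub>J\<^esub> (b \<cdot>\<^bsub>J\<^esub> a')) \<cdot>\<^bsub>J\<^esub> v'"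
      using w[OF a(1) uv(2)] w[OF a(2) uv(4)] c(2) by simp
  qed
qed

lemma is_colimitD:
  assumes "is_colimit J C D d Z z"
  shows "is_cocone J C D d Z z"
    and "is_cocone J C D d Y y \<Longrightarrow> \<exists>!h. h \<in> hom C Z Y \<and> (\<forall>i\<in>Ob J. h \<cdot>\<^bsub>C\<^esub> z i = y i)"
  using assms unfolding is_colimit_def by blast+

section \<open>Colimits of sets and of hom-sets\<close>

lemma set_hom: "x \<in> hom set_category A B \<longleftrightarrow> (\<exists>f \<in> A \<rightarrow>\<^sub>E B. x = (A, f, B))"
  by (auto simp: hom_def set_category_def)

lemma set_Comp: "(B', g, D) \<cdot>\<^bsub>set_category\<^esub> (A, f, B) = (A, compose A g f, D)"
  by (simp add: set_category_def)

lemma set_Ob: "A \<in> Ob set_category"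
  by (simp add: set_category_def)

context etopos begin

text \<open>The coprojection of \<open>D i\<close> is monic because it is the first factor of the singleton map of
  \<open>D i\<close>. The second factor comes from the cocone of maps \<open>y \<mapsto> {x. d u x = d v y}\<close> from
  \<open>D j\<close> to \<open>\<Omega>\<close> to the power \<open>D i\<close>; they do not depend on the cospan \<open>u\<close>, \<open>v\<close> under \<open>i\<close>, \<open>j\<close>.\<close>

lemma filtered_colimit_monic:
  assumes cat: "is_category J" and fil: "is_filtered J" and funct: "is_functor J E D d"
    and mon: "\<forall>u\<in>Ar J. monic E (d u)" and col: "is_colimit J E D d Z z" and i: "i \<in> Ob J"
  shows "monic E (z i)"
proof -
  have D [simp]: "D j \<in> Ob E" if "j \<in> Ob J" for j
    using funct that by (simp add: is_functor_def)
  have d [simp]: "d u \<in> Ar E" "Dom E (d u) = D j" "Cod E (d u) = D k" if "u \<in> hom J j k" for u j k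
    using funct that by (auto simp: is_functor_def Defs.hom_def)
  have d_Comp: "d (v \<cdot>\<^bsub>J\<^esub> u) = d v \<cdot> d u" if "u \<in> hom J j k" "v \<in> hom J k l" for u v j k l
    using funct that by (auto simp: is_functor_def Defs.hom_def)
  have J_Ob: "j \<in> Ob J \<and> k \<in> Ob J" if "u \<in> hom J j k" for u j k
    using cat that by (auto simp: is_category_def Defs.hom_def)
  \<comment> \<open>The truth value of the statement that \<open>y\<close> in \<open>D j\<close> and
    \<open>x\<close> in \<open>D i\<close> become equal in \<open>D k\<close>.\<close>
  define eq where "eq j k u v = equality (D k) \<cdot> pair E (d v \<cdot> Pr1 E (D j) (D i)) (d u \<cdot> Pr2 E (D j) (D i))" for j k u v
  have eq_hom: "eq j k u v \<in> hom E (Prod E (D j) (D i)) (Omega E)" if "u \<in> hom J i k" "v \<in> hom J j k" for j k u v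
    using that J_Ob[OF that(2)] i d[OF that(1)] d[OF that(2)] by (simp add: eq_def)
  have eq_Comp: "eq j l (w \<cdot>\<^bsub>J\<^esub> u) (w \<cdot>\<^bsub>J\<^esub> v) = eq j k u v"
    if u: "u \<in> hom J i k" and v: "v \<in> hom J j k" and w: "w \<in> hom J k l" for j k l u v w
  proof -
    have O: "j \<in> Ob J" "k \<in> Ob J" "l \<in> Ob J" using J_Ob[OF v] J_Ob[OF w] by auto
    have m: "monic E (d w)" using mon w by (auto simp: Defs.hom_def)
    have "equality (Cod E (d w)) \<cdot> pair E (d w \<cdot> (d v \<cdot> Pr1 E (D j) (D i))) (d w \<cdot> (d u \<cdot> Pr2 E (D j) (D i))) =
      equality (Dom E (d w)) \<cdot> pair E (d v \<cdot> Pr1 E (D j) (D i)) (d u \<cdot> Pr2 E (D j) (D i))"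
      by (rule equality_monic[OF m, of _ "Prod E (D j) (D i)"]) (use O i d[OF u] d[OF v] d[OF w] in simp_all)
    then show ?thesis
      using O i d[OF u] d[OF v] d[OF w] by (simp add: eq_def d_Comp[OF u w] d_Comp[OF v w])
  qed
  \<comment> \<open>Both cospans are compared at a common later stage; passing there changes no
    truth value, as the transition maps are monic.\<close>
  have eq_indep: "eq j k u v = eq j k' u' v'"
    if uv: "u \<in> hom J i k" "v \<in> hom J j k" "u' \<in> hom J i k'" "v' \<in> hom J j k'" for j k u v k' u' v'
  proof -
    obtain l w w' where w: "w \<in> hom J k l" "w' \<in> hom J k' l" "w \<cdot>\<^bsub>J\<^esub> u = w' \<cdot>\<^bsub>J\<^esub> u'" "w \<cdot>\<^bsub>J\<^esub> v = w' \<cdot>\<^bsub>J\<^esub> v'"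
      using filtered_span[OF cat fil uv] J_Ob uv by metis
    then show ?thesis
      using eq_Comp[OF uv(1,2) w(1)] eq_Comp[OF uv(3,4) w(2)] by simp
  qed
  have "\<forall>j\<in>Ob J. \<exists>k u v. u \<in> hom J i k \<and> v \<in> hom J j k"
    using filtered_upper_bound[OF fil i] by metis
  then obtain k u v where uv: "\<And>j. j \<in> Ob J \<Longrightarrow> u j \<in> hom J i (k j) \<and> v j \<in> hom J j (k j)"
    by metis
  define y where "y j = transpose E (D j) (D i) (Omega E) (eq j (k j) (u j) (v j))" for j
  let ?P = "Exp E (D i) (Omega E)"
  have y_hom: "y j \<in> hom E (D j) ?P" if "j \<in> Ob J" for j
    using eq_hom[of "u j" "k j" "v j" j] uv[OF that] that i by (simp add: y_def)
  have "is_cocone J E D d ?P y"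
    unfolding is_cocone_def
  proof (intro HOL.conjI ballI)
    show "?P \<in> Ob E" using i by simp
    show "y j \<in> hom E (D j) ?P" if "j \<in> Ob J" for j using y_hom[OF that] .
    fix a assume "a \<in> Ar J"
    define j where "j = Dom J a"
    define j' where "j' = Cod J a"
    have a: "a \<in> hom J j j'" using \<open>a \<in> Ar J\<close> by (simp add: j_def j'_def Defs.hom_def)
    have O: "j \<in> Ob J" "j' \<in> Ob J" using J_Ob[OF a] by auto
    note uj = uv[OF O(1)] uv[OF O(2)]
    have va: "v j' \<cdot>\<^bsub>J\<^esub> a \<in> hom J j (k j')"
      using category_Comp_hom[OF cat a] uj by blast
    have "apply_exp E (D i) (Omega E) (y j' \<cdot> (d a \<cdot> Pr1 E (D j) (D i))) (Pr2 E (D j) (D i)) =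
      eq j' (k j') (u j') (v j') \<cdot> pair E (d a \<cdot> Pr1 E (D j) (D i)) (Pr2 E (D j) (D i))"
      unfolding y_def by (rule transpose_simps(4)) (use eq_hom[of "u j'" "k j'" "v j'" j'] uj O i d[OF a] in simp_all)
    also have "\<dots> = eq j (k j') (u j') (v j' \<cdot>\<^bsub>J\<^esub> a)"
      using uj O i d[OF a] J_Ob[OF va] d[of "u j'" i "k j'"] d[of "v j'" j' "k j'"] d_Comp[OF a, of "v j'" "k j'"] by (simp add: eq_def)
    \<comment> \<open>The cospan chosen for \<open>j'\<close>, precomposed with \<open>a\<close>, is
      a cospan for \<open>j\<close> and may be exchanged for the chosen one.\<close>
    also have "\<dots> = eq j (k j) (u j) (v j)"
      using eq_indep va uj by blast
    also have "\<dots> = apply_exp E (D i) (Omega E) (y j \<cdot> Pr1 E (D j) (D i)) (Pr2 E (D j) (D i))"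
      using eq_hom[of "u j" "k j" "v j" j] uj O i by (simp add: y_def)
    finally have app: "apply_exp E (D i) (Omega E) (y j' \<cdot> (d a \<cdot> Pr1 E (D j) (D i))) (Pr2 E (D j) (D i)) =
      apply_exp E (D i) (Omega E) (y j \<cdot> Pr1 E (D j) (D i)) (Pr2 E (D j) (D i))" .
    have "y j' \<cdot> d a = y j"
      by (rule Exp_ext[of _ "D j" "D i" "Omega E"]) (use app y_hom[OF O(1)] y_hom[OF O(2)] O i d[OF a] in simp_all)
    then show "y (Cod J a) \<cdot> d a = y (Dom J a)"
      by (simp add: j_def j'_def)
  qed
  then obtain h where h: "h \<in> hom E Z ?P" "h \<cdot> z i = y i"
    using is_colimitD(2)[OF col] i by blast
  have id: "Id J i \<in> hom J i i" "d (Id J i) = Id E (D i)"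
    using cat funct i by (simp_all add: is_category_def is_functor_def)
  \<comment> \<open>For \<open>j = i\<close> the two identities form a cospan, and with it
    \<open>y i\<close> becomes the singleton map.\<close>
  have "eq i (k i) (u i) (v i) = eq i i (Id J i) (Id J i)"
    using eq_indep uv[OF i] id(1) by blast
  also have "\<dots> = equality (D i)"
    using i by (simp add: eq_def id(2))
  finally have "monic E (y i)"
    using monic_singleton[of "D i"] i by (simp add: y_def)
  moreover have "z i \<in> hom E (D i) Z"
    using is_colimitD(1)[OF col] i unfolding is_cocone_def by blast
  ultimately show ?thesis
    using monic_of_Comp[of h "z i"] h by simp
qed

lemma hom_map_eq: "f \<in> hom E A B \<Longrightarrow> hom_map E X f = (hom E X A, \<lambda>g\<in>hom E X A. f \<cdot> g, hom E X B)"
  by (auto simp: hom_map_def)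

lemma post_composition: "f \<in> hom E A B \<Longrightarrow> (\<lambda>g\<in>hom E X A. f \<cdot> g) \<in> hom E X A \<rightarrow>\<^sub>E hom E X B"
  by auto

text \<open>The union of the images of the coprojections is again a cocone, through which the colimit factors.\<close>

lemma hom_colimit_covered:
  assumes z: "\<And>i. i \<in> Ob J \<Longrightarrow> z i \<in> hom E (D i) Z"
    and col: "is_colimit J set_category (\<lambda>i. hom E X (D i)) (\<lambda>u. hom_map E X (d u)) (hom E X Z) (\<lambda>i. hom_map E X (z i))"
    and J: "\<And>u. u \<in> Ar J \<Longrightarrow> Dom J u \<in> Ob J \<and> Cod J u \<in> Ob J"
    and x: "x \<in> hom E X Z"
  shows "\<exists>i\<in>Ob J. \<exists>c\<in>hom E X (D i). z i \<cdot> c = x"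
proof -
  let ?H = "hom E X Z"
  let ?f = "\<lambda>i. \<lambda>g\<in>hom E X (D i). z i \<cdot> g"
  define U where "U = (\<Union>i\<in>Ob J. (\<lambda>c. z i \<cdot> c) ` hom E X (D i))"
  have UH: "U \<subseteq> ?H"
  proof
    fix w assume "w \<in> U"
    then obtain i c where "i \<in> Ob J" "c \<in> hom E X (D i)" "w = z i \<cdot> c" by (auto simp: U_def)
    then show "w \<in> ?H" using z[of i] by simp
  qed
  have zi: "hom_map E X (z i) = (hom E X (D i), ?f i, ?H)" if "i \<in> Ob J" for i
    using hom_map_eq[OF z[OF that]] .
  have fU: "?f i \<in> hom E X (D i) \<rightarrow>\<^sub>E U" if "i \<in> Ob J" for i
    using that by (auto simp: U_def simp del: mem_hom)
  note coc = is_colimitD(1)[OF col]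
  have "is_cocone J set_category (\<lambda>i. hom E X (D i)) (\<lambda>u. hom_map E X (d u)) U (\<lambda>i. (hom E X (D i), ?f i, U))"
    unfolding is_cocone_def
  proof (intro HOL.conjI ballI)
    show "(hom E X (D i), ?f i, U) \<in> hom set_category (hom E X (D i)) U" if "i \<in> Ob J" for i
      using fU[OF that] unfolding set_hom by blast
    fix u assume u: "u \<in> Ar J"
    obtain A g B where g: "hom_map E X (d u) = (A, g, B)" by (metis prod_cases3)
    have "hom_map E X (z (Cod J u)) \<cdot>\<^bsub>set_category\<^esub> hom_map E X (d u) = hom_map E X (z (Dom J u))"
      using coc u unfolding is_cocone_def by blast
    then show "(hom E X (D (Cod J u)), ?f (Cod J u), U) \<cdot>\<^bsub>set_category\<^esub> hom_map E X (d u) =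
        (hom E X (D (Dom J u)), ?f (Dom J u), U)"
      using J[OF u] unfolding g by (auto simp add: zi set_Comp simp del: mem_hom)
  qed (rule set_Ob)
  then obtain K where K: "K \<in> hom set_category ?H U"
    "\<And>i. i \<in> Ob J \<Longrightarrow> K \<cdot>\<^bsub>set_category\<^esub> hom_map E X (z i) = (hom E X (D i), ?f i, U)"
    using is_colimitD(2)[OF col] by blast
  then obtain \<kappa> where \<kappa>: "\<kappa> \<in> ?H \<rightarrow>\<^sub>E U" "K = (?H, \<kappa>, U)"
    unfolding set_hom by blast
  have \<kappa>f: "compose (hom E X (D i)) \<kappa> (?f i) = ?f i" if "i \<in> Ob J" for i
    using K(2)[OF that] zi[OF that] by (simp add: \<kappa>(2) set_Comp del: mem_hom)
  \<comment> \<open>As an endomap of the whole hom-set, \<open>\<kappa>\<close> agrees with the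
    identity after every coprojection. Uniqueness makes it the identity, while its values lie in
    \<open>U\<close>.\<close>
  have "\<exists>!h. h \<in> hom set_category ?H ?H \<and> (\<forall>i\<in>Ob J. h \<cdot>\<^bsub>set_category\<^esub> hom_map E X (z i) = hom_map E X (z i))"
    using is_colimitD(2)[OF col coc] .
  moreover have "(?H, \<kappa>, ?H) \<in> hom set_category ?H ?H"
    using \<kappa>(1) UH unfolding set_hom by blast
  moreover have "\<forall>i\<in>Ob J. (?H, \<kappa>, ?H) \<cdot>\<^bsub>set_category\<^esub> hom_map E X (z i) = hom_map E X (z i)"
    using zi \<kappa>f by (simp add: set_Comp del: mem_hom)
  moreover have "(?H, \<lambda>x\<in>?H. x, ?H) \<in> hom set_category ?H ?H"
    unfolding set_hom by auto
  moreover have "\<forall>i\<in>Ob J. (?H, \<lambda>x\<in>?H. x, ?H) \<cdot>\<^bsub>set_category\<^esub> hom_map E X (z i) = hom_map E X (z i)"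
  proof
    fix i assume i: "i \<in> Ob J"
    have "compose (hom E X (D i)) (\<lambda>x\<in>?H. x) (?f i) = ?f i"
      using z[OF i] by (auto simp: compose_def fun_eq_iff)
    then show "(?H, \<lambda>x\<in>?H. x, ?H) \<cdot>\<^bsub>set_category\<^esub> hom_map E X (z i) = hom_map E X (z i)"
      using zi[OF i] by (simp add: set_Comp del: mem_hom)
  qed
  ultimately have "\<kappa> = (\<lambda>x\<in>?H. x)"
    by blast
  then have "x \<in> U"
    using \<kappa>(1) x by (metis PiE_mem restrict_apply')
  then show ?thesis
    by (auto simp: U_def simp del: mem_hom)
qed

lemma hom_cocone:
  assumes col: "is_cocone J E D d Z z" and funct: "is_functor J E D d"
    and J: "\<And>u. u \<in> Ar J \<Longrightarrow> Dom J u \<in> Ob J \<and> Cod J u \<in> Ob J"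
  shows "is_cocone J set_category (\<lambda>i. hom E X (D i)) (\<lambda>u. hom_map E X (d u)) (hom E X Z) (\<lambda>i. hom_map E X (z i))"
  unfolding is_cocone_def
proof (intro HOL.conjI ballI)
  have z: "z i \<in> hom E (D i) Z" if "i \<in> Ob J" for i
    using col that unfolding is_cocone_def by blast
  show "hom_map E X (z i) \<in> hom set_category (hom E X (D i)) (hom E X Z)" if "i \<in> Ob J" for i
    unfolding hom_map_eq[OF z[OF that]] set_hom using post_composition[OF z[OF that]] by blast
  fix u assume u: "u \<in> Ar J"
  have d: "d u \<in> hom E (D (Dom J u)) (D (Cod J u))"
    using funct u unfolding is_functor_def by blast
  have zd: "z (Cod J u) \<cdot> d u = z (Dom J u)"
    using col u unfolding is_cocone_def by blast
  have "compose (hom E X (D (Dom J u))) (\<lambda>g\<in>hom E X (D (Cod J u)). z (Cod J u) \<cdot> g) (\<lambda>g\<in>hom E X (D (Dom J u)). d u \<cdot> g) =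
    (\<lambda>g\<in>hom E X (D (Dom J u)). z (Dom J u) \<cdot> g)"
  proof
    fix g
    show "compose (hom E X (D (Dom J u))) (\<lambda>g\<in>hom E X (D (Cod J u)). z (Cod J u) \<cdot> g) (\<lambda>g\<in>hom E X (D (Dom J u)). d u \<cdot> g) g =
      (\<lambda>g\<in>hom E X (D (Dom J u)). z (Dom J u) \<cdot> g) g"
    proof (cases "g \<in> hom E X (D (Dom J u))")
      case True
      then have "z (Cod J u) \<cdot> (d u \<cdot> g) = z (Dom J u) \<cdot> g"
        using d z J[OF u] by (simp flip: zd)
      then show ?thesis
        using True d by (simp add: compose_def)
    qed (simp add: compose_def del: mem_hom)
  qed
  then show "hom_map E X (z (Cod J u)) \<cdot>\<^bsub>set_category\<^esub> hom_map E X (d u) = hom_map E X (z (Dom J u))"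
    using hom_map_eq[OF d] hom_map_eq[OF z] J[OF u] by (simp add: set_Comp del: mem_hom)
qed (rule set_Ob)

text \<open>Monic coprojections embed the hom-sets of the diagram into \<open>hom E X Z\<close>, so
  being a colimit amounts to covering it. A compatible family is glued by choosing a factorisation
  of each map.\<close>

lemma hom_colimitI:
  assumes cat: "is_category J" and fil: "is_filtered J" and funct: "is_functor J E D d"
    and col: "is_cocone J E D d Z z" and mon: "\<And>i. i \<in> Ob J \<Longrightarrow> monic E (z i)"
    and surj: "\<And>x. x \<in> hom E X Z \<Longrightarrow> \<exists>i\<in>Ob J. \<exists>c\<in>hom E X (D i). z i \<cdot> c = x"
  shows "is_colimit J set_category (\<lambda>i. hom E X (D i)) (\<lambda>u. hom_map E X (d u)) (hom E X Z) (\<lambda>i. hom_map E X (z i))"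
proof -
  have J: "\<And>u. u \<in> Ar J \<Longrightarrow> Dom J u \<in> Ob J \<and> Cod J u \<in> Ob J"
    using cat unfolding is_category_def by blast
  have z: "z i \<in> hom E (D i) Z" if "i \<in> Ob J" for i
    using col that unfolding is_cocone_def by blast
  have d: "d u \<in> hom E (D (Dom J u)) (D (Cod J u))" if "u \<in> Ar J" for u
    using funct that unfolding is_functor_def by blast
  have zd: "z (Cod J u) \<cdot> d u = z (Dom J u)" if "u \<in> Ar J" for u
    using col that unfolding is_cocone_def by blast
  have "\<exists>!h. h \<in> hom set_category (hom E X Z) B \<and> (\<forall>i\<in>Ob J. h \<cdot>\<^bsub>set_category\<^esub> hom_map E X (z i) = y i)"
    if y: "is_cocone J set_category (\<lambda>i. hom E X (D i)) (\<lambda>u. hom_map E X (d u)) B y" for B y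
  proof -
    have "\<forall>i\<in>Ob J. \<exists>f. f \<in> hom E X (D i) \<rightarrow>\<^sub>E B \<and> y i = (hom E X (D i), f, B)"
      using y unfolding is_cocone_def set_hom by blast
    then obtain \<eta> where \<eta>: "\<And>i. i \<in> Ob J \<Longrightarrow> \<eta> i \<in> hom E X (D i) \<rightarrow>\<^sub>E B"
      "\<And>i. i \<in> Ob J \<Longrightarrow> y i = (hom E X (D i), \<eta> i, B)"
      by metis
    have \<eta>d: "\<eta> (Cod J u) (d u \<cdot> g) = \<eta> (Dom J u) g" if u: "u \<in> Ar J" and g: "g \<in> hom E X (D (Dom J u))" for u g
    proof -
      have "y (Cod J u) \<cdot>\<^bsub>set_category\<^esub> hom_map E X (d u) = y (Dom J u)"
        using y u unfolding is_cocone_def by blast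
      then have "compose (hom E X (D (Dom J u))) (\<eta> (Cod J u)) (\<lambda>g\<in>hom E X (D (Dom J u)). d u \<cdot> g) = \<eta> (Dom J u)"
        using hom_map_eq[OF d[OF u]] J[OF u] by (simp add: \<eta>(2) set_Comp del: mem_hom)
      then show ?thesis
        using g by (metis (no_types, lifting) compose_eq restrict_apply')
    qed
    \<comment> \<open>Two factorisations of one map agree in a common later \<open>D k\<close>
      because \<open>z k\<close> is monic, so the glued value does not depend on the choice.\<close>
    have wd: "\<eta> i g = \<eta> j g'"
      if ij: "i \<in> Ob J" "j \<in> Ob J" and g: "g \<in> hom E X (D i)" "g' \<in> hom E X (D j)" and eq: "z i \<cdot> g = z j \<cdot> g'" for i j g g'
    proof -
      obtain k u v where "u \<in> hom J i k" "v \<in> hom J j k"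
        using filtered_upper_bound[OF fil ij] .
      then have u: "u \<in> Ar J" "Dom J u = i" "Cod J u = k" and v: "v \<in> Ar J" "Dom J v = j" "Cod J v = k"
        by (simp_all add: Defs.hom_def)
      have k: "k \<in> Ob J" using J[OF u(1)] u by simp
      have "z k \<cdot> (d u \<cdot> g) = (z k \<cdot> d u) \<cdot> g" "z k \<cdot> (d v \<cdot> g') = (z k \<cdot> d v) \<cdot> g'"
        using d[OF u(1)] d[OF v(1)] z[OF k] g u v by simp_all
      then have "z k \<cdot> (d u \<cdot> g) = z k \<cdot> (d v \<cdot> g')"
        using zd[OF u(1)] zd[OF v(1)] u v eq by simp
      then have "d u \<cdot> g = d v \<cdot> g'"
        by (rule monic_cancel[OF mon[OF k], rotated -1]) (use d[OF u(1)] d[OF v(1)] z[OF k] g u v in simp_all)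
      then show ?thesis
        using \<eta>d[OF u(1), of g] \<eta>d[OF v(1), of g'] g u v by (simp del: mem_hom)
    qed
    obtain I G where IG: "\<And>x. x \<in> hom E X Z \<Longrightarrow> I x \<in> Ob J \<and> G x \<in> hom E X (D (I x)) \<and> z (I x) \<cdot> G x = x"
      using surj by metis
    define h where "h = (\<lambda>x\<in>hom E X Z. \<eta> (I x) (G x))"
    have h: "h \<in> hom E X Z \<rightarrow>\<^sub>E B"
      unfolding h_def using IG \<eta>(1) by (auto simp del: mem_hom)
    have zg: "z i \<cdot> g \<in> hom E X Z" if "i \<in> Ob J" "g \<in> hom E X (D i)" for i g
      using z[OF that(1)] that(2) by simp
    have hz: "h (z i \<cdot> g) = \<eta> i g" if "i \<in> Ob J" "g \<in> hom E X (D i)" for i g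
      using wd[of "I (z i \<cdot> g)" i "G (z i \<cdot> g)" g] IG[OF zg[OF that]] zg[OF that] that by (simp add: h_def del: mem_hom)
    show ?thesis
    proof (rule ex1I[of _ "(hom E X Z, h, B)"])
      have "compose (hom E X (D i)) h (\<lambda>g\<in>hom E X (D i). z i \<cdot> g) = \<eta> i" if i: "i \<in> Ob J" for i
      proof (rule extensionalityI[of _ "hom E X (D i)"])
        show "\<eta> i \<in> extensional (hom E X (D i))" using \<eta>(1)[OF i] by (simp add: PiE_iff)
        show "compose (hom E X (D i)) h (\<lambda>g\<in>hom E X (D i). z i \<cdot> g) g = \<eta> i g" if "g \<in> hom E X (D i)" for g
          using hz[OF i that] that by (simp add: compose_def del: mem_hom)
      qed (rule compose_extensional)
      then have "\<forall>i\<in>Ob J. (hom E X Z, h, B) \<cdot>\<^bsub>set_category\<^esub> hom_map E X (z i) = y i"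
        by (simp add: \<eta>(2) hom_map_eq[OF z] set_Comp del: mem_hom)
      moreover have "(hom E X Z, h, B) \<in> hom set_category (hom E X Z) B"
        unfolding set_hom using h by blast
      ultimately show "(hom E X Z, h, B) \<in> hom set_category (hom E X Z) B \<and>
          (\<forall>i\<in>Ob J. (hom E X Z, h, B) \<cdot>\<^bsub>set_category\<^esub> hom_map E X (z i) = y i)"
        by blast
    next
      fix H assume H: "H \<in> hom set_category (hom E X Z) B \<and> (\<forall>i\<in>Ob J. H \<cdot>\<^bsub>set_category\<^esub> hom_map E X (z i) = y i)"
      then obtain h' where h': "h' \<in> hom E X Z \<rightarrow>\<^sub>E B" "H = (hom E X Z, h', B)"
        unfolding set_hom by blast
      have "h' = h"
      proof (rule extensionalityI[of _ "hom E X Z"])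
        show "h' \<in> extensional (hom E X Z)" "h \<in> extensional (hom E X Z)"
          using h h'(1) by (simp_all add: PiE_iff)
        fix x assume "x \<in> hom E X Z"
        then obtain i g where i: "i \<in> Ob J" and g: "g \<in> hom E X (D i)" and x: "z i \<cdot> g = x"
          using surj by blast
        have "H \<cdot>\<^bsub>set_category\<^esub> hom_map E X (z i) = y i"
          using H i by blast
        then have "compose (hom E X (D i)) h' (\<lambda>g\<in>hom E X (D i). z i \<cdot> g) = \<eta> i"
          using i by (simp add: h'(2) \<eta>(2) hom_map_eq[OF z] set_Comp del: mem_hom)
        then have "h' (z i \<cdot> g) = \<eta> i g"
          using g by (metis (no_types, lifting) compose_eq restrict_apply')
        then show "h' x = h x"
          using hz[OF i g] x by simp
      qed
      then show "H = (hom E X Z, h, B)"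
        using h'(2) by simp
    qed
  qed
  then show ?thesis
    unfolding is_colimit_def using hom_cocone[OF col funct J] by blast
qed

lemma compact_cover:
  fixes V :: "'v itself"
  assumes C: "compact V E (Dom E e)" and e: "cover e"
  shows "compact V E (Cod E e)"
  unfolding compact_def
proof (intro HOL.conjI allI impI)
  show "Cod E e \<in> Ob E" using e by simp
  fix J :: "('v, 'v) category" and D d Z z
  assume J_conj: "is_category J \<and> small V (Ob J) \<and> small V (Ar J) \<and> is_filtered J \<and>
        is_functor J E D d \<and> (\<forall>u\<in>Ar J. monic E (d u)) \<and> is_colimit J E D d Z z"
  then have *: "is_category J" "is_filtered J" "is_functor J E D d" "\<forall>u\<in>Ar J. monic E (d u)" "is_colimit J E D d Z z"
    by simp_all
  note mon = filtered_colimit_monic[OF *]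
  have coc: "is_cocone J E D d Z z"
    using is_colimitD(1)[OF *(5)] .
  then have z: "z i \<in> hom E (D i) Z" if "i \<in> Ob J" for i
    using that unfolding is_cocone_def by blast
  have hcol: "is_colimit J set_category (\<lambda>i. hom E (Dom E e) (D i)) (\<lambda>u. hom_map E (Dom E e) (d u))
      (hom E (Dom E e) Z) (\<lambda>i. hom_map E (Dom E e) (z i))"
    using C J_conj unfolding compact_def by blast
  have J: "Dom J u \<in> Ob J \<and> Cod J u \<in> Ob J" if "u \<in> Ar J" for u
    using *(1) that unfolding is_category_def by blast
  show "is_colimit J set_category (\<lambda>i. hom E (Cod E e) (D i)) (\<lambda>u. hom_map E (Cod E e) (d u))
      (hom E (Cod E e) Z) (\<lambda>i. hom_map E (Cod E e) (z i))"
  proof (rule hom_colimitI)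
    fix x assume x: "x \<in> hom E (Cod E e) Z"
    then have "x \<cdot> e \<in> hom E (Dom E e) Z"
      using e by simp
    then obtain i c where i: "i \<in> Ob J" and c: "c \<in> hom E (Dom E e) (D i)" and eq: "z i \<cdot> c = x \<cdot> e"
      using hom_colimit_covered[OF z hcol J] by blast
    \<comment> \<open>The diagonal of the square formed by \<open>e\<close> and the monic
      \<open>z i\<close> is the factorisation sought.\<close>
    obtain y where y: "y \<in> hom E (Cod E e) (Dom E (z i))" "z i \<cdot> y = x"
      by (rule cover_orthogonal[OF e mon[OF i], of x c]) (use x c z[OF i] eq in simp_all)
    moreover have "Dom E (z i) = D i"
      using z[OF i] by simp
    ultimately show "\<exists>i\<in>Ob J. \<exists>c\<in>hom E (Cod E e) (D i). z i \<cdot> c = x"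
      using i by metis
  qed (fact *(1-3) coc mon)+
qed

end

section \<open>Automata\<close>

context etopos begin

section \<open>Monoids, endomorphism monoids and the two halves of the equivalence\<close>

text \<open>Inverse image on generalised elements. Together with \<open>classifies_iff\<close> it
  turns the pullback in \<open>recognizes\<close> into an acceptance condition.\<close>

lemma pullback_factor:
  assumes pb: "is_pullback E f m p q" and b: "b \<in> hom E T (Dom E f)"
  shows "(\<exists>h \<in> hom E T (Dom E m). m \<cdot> h = f \<cdot> b) \<longleftrightarrow> (\<exists>h \<in> hom E T (Dom E p). p \<cdot> h = b)"
proof
  note p = pullbackD[OF pb]
  show "\<exists>h \<in> hom E T (Dom E p). p \<cdot> h = b" if "\<exists>h \<in> hom E T (Dom E m). m \<cdot> h = f \<cdot> b"
    using pullback_ex1[OF pb b] that by metis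
  show "\<exists>h \<in> hom E T (Dom E m). m \<cdot> h = f \<cdot> b" if ex: "\<exists>h \<in> hom E T (Dom E p). p \<cdot> h = b"
  proof -
    obtain h where h: "h \<in> hom E T (Dom E p)" "p \<cdot> h = b"
      using ex by blast
    have "m \<cdot> (q \<cdot> h) = f \<cdot> (p \<cdot> h)"
      using p h(1) Comp_assoc[of h q m] Comp_assoc[of h p f] by simp
    moreover have "q \<cdot> h \<in> hom E T (Dom E m)"
      using p h(1) by simp
    ultimately show ?thesis
      using h(2) by metis
  qed
qed

lemma monoidD:
  assumes "is_monoid E M m e"
  shows "M \<in> Ob E" "m \<in> Ar E" "Dom E m = Prod E M M" "Cod E m = M" "e \<in> Ar E" "Dom E e = One E" "Cod E e = M"
    and "\<lbrakk>x \<in> hom E X M; y \<in> hom E X M; z \<in> hom E X M\<rbrakk> \<Longrightarrow>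
      m \<cdot> pair E (m \<cdot> pair E x y) z = m \<cdot> pair E x (m \<cdot> pair E y z)"
    and "x \<in> hom E X M \<Longrightarrow> m \<cdot> pair E (e \<cdot> bang E X) x = x"
    and "x \<in> hom E X M \<Longrightarrow> m \<cdot> pair E x (e \<cdot> bang E X) = x"
proof -
  show "M \<in> Ob E" "m \<in> Ar E" "Dom E m = Prod E M M" "Cod E m = M" "e \<in> Ar E" "Dom E e = One E" "Cod E e = M"
    using assms unfolding is_monoid_def by simp_all
  have X: "X \<in> Ob E" if "x \<in> hom E X M" for x X using that by auto
  show "\<lbrakk>x \<in> hom E X M; y \<in> hom E X M; z \<in> hom E X M\<rbrakk> \<Longrightarrow>
      m \<cdot> pair E (m \<cdot> pair E x y) z = m \<cdot> pair E x (m \<cdot> pair E y z)"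
    "x \<in> hom E X M \<Longrightarrow> m \<cdot> pair E (e \<cdot> bang E X) x = x"
    "x \<in> hom E X M \<Longrightarrow> m \<cdot> pair E x (e \<cdot> bang E X) = x"
    using assms X unfolding is_monoid_def by blast+
qed

lemma endo_mult_simps [simp]:
  assumes S: "S \<in> Ob E"
  shows "endo_mult E S \<in> Ar E" "Dom E (endo_mult E S) = Prod E (Exp E S S) (Exp E S S)" "Cod E (endo_mult E S) = Exp E S S"
    "\<lbrakk>f \<in> hom E (Dom E s) (Exp E S S); g \<in> hom E (Dom E s) (Exp E S S); s \<in> Ar E; Cod E s = S\<rbrakk> \<Longrightarrow>
      apply_exp E S S (endo_mult E S \<cdot> pair E f g) s = apply_exp E S S g (apply_exp E S S f s)"
  using S by (simp_all add: endo_mult_def Let_def)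

lemma endo_unit_simps [simp]:
  assumes S: "S \<in> Ob E"
  shows "endo_unit E S \<in> Ar E" "Dom E (endo_unit E S) = One E" "Cod E (endo_unit E S) = Exp E S S"
    "\<lbrakk>s \<in> Ar E; Cod E s = S; t \<in> hom E (Dom E s) (One E)\<rbrakk> \<Longrightarrow> apply_exp E S S (endo_unit E S \<cdot> t) s = s"
  using S by (simp_all add: endo_unit_def)

text \<open>States are the classes \<open>q v\<close> of words, and a word \<open>w\<close> acts by \<open>q v \<mapsto> q (v w)\<close>.\<close>

lemma myhill_nerode_automaton:
  assumes free: "is_free_monoid E A W w e i" and L: "L \<in> hom E W (Omega E)"
    and mn: "is_myhill_nerode_quotient E W w L Q"
  shows "\<exists>M. deterministic_automaton E A M \<and> States M = Q \<and> recognizes E A W w e i M L"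
proof -
  have mon: "is_monoid E W w e" and A [simp]: "A \<in> Ob E" and i: "i \<in> Ar E" "Dom E i = A" "Cod E i = W"
    using free by (simp_all add: is_free_monoid_def)
  note M = monoidD(1-7)[OF mon]
  note assoc = monoidD(8)[OF mon] and unit_l = monoidD(9)[OF mon] and unit_r = monoidD(10)[OF mon]
  note [simp] = M i
  have L': "L \<in> Ar E" "Dom E L = W" "Cod E L = Omega E" using L by simp_all
  note [simp] = L'
  let ?f = "transpose E W W (Omega E) (L \<cdot> w)"
  obtain k l q where kp: "is_kernel_pair E ?f k l" and co: "is_coequaliser E k l q" and Q: "Cod E q = Q"
    using mn unfolding is_myhill_nerode_quotient_def by blast
  have pb: "is_pullback E ?f ?f k l" using kp by (simp add: is_kernel_pair_def)
  note p = pullbackD[OF pb]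
  note c = coequaliserD[OF co]
  let ?K = "Dom E k"
  have kl [simp]: "k \<in> Ar E" "l \<in> Ar E" "Cod E k = W" "Cod E l = W" "Dom E l = ?K"
    using p by simp_all
  have q [simp]: "q \<in> Ar E" "Dom E q = W" using c(3,6) by simp_all
  have QO [simp]: "Q \<in> Ob E" using Ob_Dom_Cod(2)[OF q(1)] Q by simp
  note [simp] = Q
  \<comment> \<open>Words with the same set of accepted continuations form an element of the kernel
    pair, which \<open>q\<close> identifies.\<close>
  have q_iff: "q \<cdot> a = q \<cdot> b" if ab: "a \<in> hom E T W" "b \<in> hom E T W" "?f \<cdot> a = ?f \<cdot> b" for T a b
  proof -
    obtain h where h: "h \<in> hom E T ?K" "k \<cdot> h = a" "l \<cdot> h = b"
      using pullback_ex1[OF pb, of a T b] ab by auto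
    have "q \<cdot> (k \<cdot> h) = q \<cdot> (l \<cdot> h)"
      using h(1) c(7) Comp_assoc[of h k q] Comp_assoc[of h l q] by simp
    then show ?thesis using h by simp
  qed
  \<comment> \<open>Evaluate the equation of the kernel pair at a continuation
    \<open>v\<close>.\<close>
  have Lkl: "L \<cdot> (w \<cdot> pair E (k \<cdot> t) v) = L \<cdot> (w \<cdot> pair E (l \<cdot> t) v)"
    if tv: "t \<in> hom E T ?K" "v \<in> hom E T W" for T t v
  proof -
    have "(?f \<cdot> k) \<cdot> t = (?f \<cdot> l) \<cdot> t" by (simp only: p(9))
    then have "?f \<cdot> (k \<cdot> t) = ?f \<cdot> (l \<cdot> t)" using tv by simp
    then have "apply_exp E W (Omega E) (?f \<cdot> (k \<cdot> t)) v = apply_exp E W (Omega E) (?f \<cdot> (l \<cdot> t)) v" by simp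
    then show ?thesis using tv by simp
  qed
  obtain act where act: "act \<in> hom E (Prod E Q W) Q"
    and act_q': "\<And>T v a. v \<in> hom E T W \<Longrightarrow> a \<in> hom E T W \<Longrightarrow> act \<cdot> pair E (q \<cdot> v) a = (q \<cdot> w) \<cdot> pair E v a"
  proof -
    let ?P = "Prod E ?K W" and ?k = "k \<cdot> Pr1 E ?K W" and ?l = "l \<cdot> Pr1 E ?K W" and ?v = "Pr2 E ?K W"
    \<comment> \<open>The congruence property: by associativity, a continuation \<open>a\<close> of
      \<open>x u\<close> is the continuation \<open>u a\<close> of \<open>x\<close>.\<close>
    have "?f \<cdot> (w \<cdot> pair E ?k ?v) = ?f \<cdot> (w \<cdot> pair E ?l ?v)"
    proof (rule Exp_ext_elements[of _ ?P W "Omega E"])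
      fix T t a assume t: "t \<in> hom E T ?P" and a: "a \<in> hom E T W"
      let ?t = "Pr1 E ?K W \<cdot> t" and ?u = "Pr2 E ?K W \<cdot> t"
      have "w \<cdot> pair E (w \<cdot> pair E (k \<cdot> ?t) ?u) a = w \<cdot> pair E (k \<cdot> ?t) (w \<cdot> pair E ?u a)"
        "w \<cdot> pair E (w \<cdot> pair E (l \<cdot> ?t) ?u) a = w \<cdot> pair E (l \<cdot> ?t) (w \<cdot> pair E ?u a)"
        using t a by (intro assoc; simp)+
      then show "apply_exp E W (Omega E) ((?f \<cdot> (w \<cdot> pair E ?k ?v)) \<cdot> t) a = apply_exp E W (Omega E) ((?f \<cdot> (w \<cdot> pair E ?l ?v)) \<cdot> t) a"
        using Lkl[of ?t T "w \<cdot> pair E ?u a"] t a by simp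
    qed simp_all
    then have "q \<cdot> (w \<cdot> pair E ?k ?v) = q \<cdot> (w \<cdot> pair E ?l ?v)"
      by (intro q_iff[of _ ?P]) simp_all
    then have eq: "(q \<cdot> w) \<cdot> pair E ?k ?v = (q \<cdot> w) \<cdot> pair E ?l ?v"
      by simp
    show thesis
      by (rule coequaliser_Prod[OF co M(1) _ eq, of Q]) (use that in simp_all)
  qed
  have act' [simp]: "act \<in> Ar E" "Dom E act = Prod E Q W" "Cod E act = Q" using act by simp_all
  have act_q: "act \<cdot> pair E (q \<cdot> v) a = q \<cdot> (w \<cdot> pair E v a)" if "v \<in> hom E T W" "a \<in> hom E T W" for T v a
    using act_q'[OF that] that by simp
  have act_e: "act \<cdot> pair E s (e \<cdot> t) = s" if s: "s \<in> hom E T Q" "t \<in> hom E T (One E)" for T s t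
  proof -
    \<comment> \<open>The law is stated for the generic state, where \<open>q\<close> can be
      cancelled; on classes of words it is the right unit law of \<open>W\<close>.\<close>
    have "act \<cdot> pair E (Pr1 E Q (One E)) (e \<cdot> Pr2 E Q (One E)) = Pr1 E Q (One E)"
    proof (rule coequaliser_Prod_cancel[OF co One_Ob, of _ Q])
      fix T v a assume v: "v \<in> hom E T (Cod E k)" "a \<in> hom E T (One E)"
      then have "a = bang E T" using bang_unique[of a] by simp
      then show "(act \<cdot> pair E (Pr1 E Q (One E)) (e \<cdot> Pr2 E Q (One E))) \<cdot> pair E (q \<cdot> v) a = Pr1 E Q (One E) \<cdot> pair E (q \<cdot> v) a"
        using v act_q[of v T "e \<cdot> a"] unit_r[of v T] by simp
    qed simp_all
    then have "(act \<cdot> pair E (Pr1 E Q (One E)) (e \<cdot> Pr2 E Q (One E))) \<cdot> pair E s t = Pr1 E Q (One E) \<cdot> pair E s t"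
      by simp
    then show ?thesis using s by simp
  qed
  have act_w: "act \<cdot> pair E s (w \<cdot> pair E x y) = act \<cdot> pair E (act \<cdot> pair E s x) y"
    if s: "s \<in> hom E T Q" "x \<in> hom E T W" "y \<in> hom E T W" for T s x y
  proof -
    let ?WW = "Prod E W W"
    let ?s = "Pr1 E Q ?WW" and ?x = "Pr1 E W W \<cdot> Pr2 E Q ?WW" and ?y = "Pr2 E W W \<cdot> Pr2 E Q ?WW"
    have WW: "?WW \<in> Ob E" by simp
    \<comment> \<open>The two words are packed into one parameter from \<open>Prod E W W\<close>,
      and cancelling \<open>q\<close> leaves associativity in \<open>W\<close>.\<close>
    have "act \<cdot> pair E ?s (w \<cdot> pair E ?x ?y) = act \<cdot> pair E (act \<cdot> pair E ?s ?x) ?y"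
    proof (rule coequaliser_Prod_cancel[OF co WW, of _ Q])
      fix T v a assume v: "v \<in> hom E T (Cod E k)" "a \<in> hom E T ?WW"
      let ?a = "Pr1 E W W \<cdot> a" and ?b = "Pr2 E W W \<cdot> a"
      have "act \<cdot> pair E (q \<cdot> v) (w \<cdot> pair E ?a ?b) = q \<cdot> (w \<cdot> pair E v (w \<cdot> pair E ?a ?b))"
        using v by (intro act_q) simp_all
      also have "\<dots> = q \<cdot> (w \<cdot> pair E (w \<cdot> pair E v ?a) ?b)"
        using assoc[of v T ?a ?b] v by simp
      also have "\<dots> = act \<cdot> pair E (q \<cdot> (w \<cdot> pair E v ?a)) ?b"
        using act_q[of "w \<cdot> pair E v ?a" T ?b] v by simp
      also have "\<dots> = act \<cdot> pair E (act \<cdot> pair E (q \<cdot> v) ?a) ?b"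
        using act_q[of v T ?a] v by simp
      finally show "(act \<cdot> pair E ?s (w \<cdot> pair E ?x ?y)) \<cdot> pair E (q \<cdot> v) a = (act \<cdot> pair E (act \<cdot> pair E ?s ?x) ?y) \<cdot> pair E (q \<cdot> v) a"
        using v by simp
    qed simp_all
    then have "(act \<cdot> pair E ?s (w \<cdot> pair E ?x ?y)) \<cdot> pair E s (pair E x y) = (act \<cdot> pair E (act \<cdot> pair E ?s ?x) ?y) \<cdot> pair E s (pair E x y)"
      by simp
    then show ?thesis using s by simp
  qed
  \<comment> \<open>\<open>act\<close> takes the state first, whereas the transpose into
    \<open>Exp E Q Q\<close> needs it as the second argument; hence the exchange.\<close>
  define h where "h = transpose E W Q Q (act \<cdot> pair E (Pr2 E W Q) (Pr1 E W Q))"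
  have h [simp]: "h \<in> Ar E" "Dom E h = W" "Cod E h = Exp E Q Q"
    by (simp_all add: h_def)
  have h_app: "apply_exp E Q Q (h \<cdot> x) s = act \<cdot> pair E s x" if "x \<in> hom E T W" "s \<in> hom E T Q" for T x s
    using that by (simp add: h_def)
  \<comment> \<open>Taking the empty word as continuation shows that \<open>L\<close> itself
    descends to a predicate \<open>\<chi>\<close> on classes, which provides the final
    states.\<close>
  have "(L \<cdot> k) = L \<cdot> l"
    using Lkl[of "Id E ?K" ?K "e \<cdot> bang E ?K"] unit_r[of k ?K] unit_r[of l ?K] by simp
  then obtain \<chi> where \<chi>: "\<chi> \<in> hom E Q (Omega E)" "\<chi> \<cdot> q = L"
    using coequaliser_ex1[OF co, of L "Omega E"] by auto
  obtain F where F: "monic E F" "Cod E F = Q"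
    and F_iff: "\<And>T b. b \<in> hom E T Q \<Longrightarrow> \<chi> \<cdot> b = true_at T \<longleftrightarrow> (\<exists>h \<in> hom E T (Dom E F). F \<cdot> h = b)"
    using comprehension[OF \<chi>(1)] by metis
  define M where "M = \<lparr>States = Q, Start = q \<cdot> e, Final = F, Step = act \<cdot> pair E (Pr2 E A Q) (i \<cdot> Pr1 E A Q)\<rparr>"
  have "deterministic_automaton E A M"
    using F by (simp add: deterministic_automaton_def M_def)
  moreover have "is_run E A W w e i M q"
    unfolding is_run_def Let_def
  proof (intro HOL.exI[of _ h] HOL.conjI)
    have "h \<cdot> e = endo_unit E Q"
    proof (rule Exp_ext_elements[of _ "One E" Q Q])
      show "apply_exp E Q Q ((h \<cdot> e) \<cdot> t) a = apply_exp E Q Q (endo_unit E Q \<cdot> t) a"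
        if "t \<in> hom E T (One E)" "a \<in> hom E T Q" for T t a
        using that h_app[of "e \<cdot> t" T a] act_e[of a T t] by simp
    qed simp_all
    moreover have "h \<cdot> w = endo_mult E Q \<cdot> pair E (h \<cdot> Pr1 E W W) (h \<cdot> Pr2 E W W)"
    proof (rule Exp_ext_elements[of _ "Prod E W W" Q Q])
      fix T t a assume t: "t \<in> hom E T (Prod E W W)" "a \<in> hom E T Q"
      let ?x = "Pr1 E W W \<cdot> t" and ?y = "Pr2 E W W \<cdot> t"
      have wt: "w \<cdot> t = w \<cdot> pair E ?x ?y"
        using pair_eta[of t W W] t by simp
      have "apply_exp E Q Q ((h \<cdot> w) \<cdot> t) a = act \<cdot> pair E a (w \<cdot> pair E ?x ?y)"
        using h_app[of "w \<cdot> t" T a] t wt by simp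
      also have "\<dots> = act \<cdot> pair E (act \<cdot> pair E a ?x) ?y"
        using t by (intro act_w) simp_all
      also have "\<dots> = apply_exp E Q Q (h \<cdot> ?y) (apply_exp E Q Q (h \<cdot> ?x) a)"
        using t h_app[of ?x T a] h_app[of ?y T "act \<cdot> pair E a ?x"] by simp
      also have "\<dots> = apply_exp E Q Q ((endo_mult E Q \<cdot> pair E (h \<cdot> Pr1 E W W) (h \<cdot> Pr2 E W W)) \<cdot> t) a"
        using t by simp
      finally show "apply_exp E Q Q ((h \<cdot> w) \<cdot> t) a = \<dots>" .
    qed simp_all
    ultimately show "is_monoid_hom E W w e (Exp E (States M) (States M)) (endo_mult E (States M)) (endo_unit E (States M)) h"
      by (simp add: is_monoid_hom_def M_def)
    have "h \<cdot> i = transpose E A Q Q (act \<cdot> pair E (Pr2 E A Q) (i \<cdot> Pr1 E A Q))"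
    proof (rule Exp_ext_elements[of _ A Q Q])
      show "apply_exp E Q Q ((h \<cdot> i) \<cdot> t) a = apply_exp E Q Q (transpose E A Q Q (act \<cdot> pair E (Pr2 E A Q) (i \<cdot> Pr1 E A Q)) \<cdot> t) a"
        if "t \<in> hom E T A" "a \<in> hom E T Q" for T t a
        using that h_app[of "i \<cdot> t" T a] by simp
    qed simp_all
    then show "h \<cdot> i = transpose E A (States M) (States M) (Step M)"
      by (simp add: M_def)
    \<comment> \<open>The run map is \<open>q\<close> itself: from the class of the empty word, a
      word \<open>x\<close> leads to the class of \<open>e x\<close>, which is
      \<open>x\<close>.\<close>
    have "apply_exp E Q Q (h \<cdot> Id E W) (q \<cdot> (e \<cdot> bang E W)) = act \<cdot> pair E (q \<cdot> (e \<cdot> bang E W)) (Id E W)"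
      by (rule h_app[of _ W]) simp_all
    also have "\<dots> = q \<cdot> (w \<cdot> pair E (e \<cdot> bang E W) (Id E W))"
      by (rule act_q[of _ W]) simp_all
    also have "\<dots> = q"
      using unit_l[of "Id E W" W] by simp
    finally show "q = apply_exp E (States M) (States M) h (Start M \<cdot> bang E W)"
      by (simp add: M_def)
  qed
  moreover obtain p p' where pb': "is_pullback E q F p p'"
    using pullback_ex[of q F] F by auto
  moreover have "classifies E L p"
  proof -
    note p = pullbackD[OF pb']
    have pm: "monic E p" using pullback_monic[OF pb' F(1)] .
    have L_iff: "L \<cdot> b = true_at T \<longleftrightarrow> (\<exists>h \<in> hom E T (Dom E p). p \<cdot> h = b)" if b: "b \<in> hom E T W" for T b
    proof -
      have "L \<cdot> b = \<chi> \<cdot> (q \<cdot> b)"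
        using \<chi>(1) b by (simp flip: \<chi>(2))
      also have "\<dots> = true_at T \<longleftrightarrow> (\<exists>h \<in> hom E T (Dom E F). F \<cdot> h = q \<cdot> b)"
        using F_iff[of "q \<cdot> b" T] b by simp
      also have "\<dots> \<longleftrightarrow> (\<exists>h \<in> hom E T (Dom E p). p \<cdot> h = b)"
        using pullback_factor[OF pb', of b T] b by simp
      finally show ?thesis .
    qed
    have W: "Cod E p = W"
      using p(7) by simp
    have "classifies E L p \<longleftrightarrow> (\<forall>T. \<forall>b \<in> hom E T W. L \<cdot> b = true_at T \<longleftrightarrow> (\<exists>h \<in> hom E T (Dom E p). p \<cdot> h = b))"
      using classifies_iff[OF pm, of L, unfolded W] L by blast
    then show ?thesis
      using L_iff by blast
  qed
  ultimately have "recognizes E A W w e i M L"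
    unfolding recognizes_def by (auto simp: M_def)
  then show ?thesis
    using \<open>deterministic_automaton E A M\<close> by (intro HOL.exI[of _ M]) (simp add: M_def)
qed

text \<open>For a word \<open>x\<close> and its state \<open>r x\<close>, acceptance of \<open>x y\<close> depends on \<open>r x\<close> only, so the map to
  the power object of words whose kernel pair defines the quotient factors through \<open>r\<close>. By injectivity
  of power objects it further factors through a compact object containing the states.\<close>

lemma myhill_nerode_sub_compact:
  assumes free: "is_free_monoid E A W w e i" and L: "L \<in> hom E W (Omega E)"
    and mn: "is_myhill_nerode_quotient E W w L Q"
    and M: "deterministic_automaton E A M" "recognizes E A W w e i M L"
    and sc: "sub_compact V E (States M)"
  shows "sub_compact V E Q"
proof -
  have mon: "is_monoid E W w e"
    using free by (simp add: is_free_monoid_def)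
  note [simp] = monoidD(1-7)[OF mon]
  have L' [simp]: "L \<in> Ar E" "Dom E L = W" "Cod E L = Omega E" using L by simp_all
  define S where "S = States M"
  have S [simp]: "S \<in> Ob E" "Start M \<in> Ar E" "Dom E (Start M) = One E" "Cod E (Start M) = S"
    and F: "monic E (Final M)" "Cod E (Final M) = S"
    using M(1) by (simp_all add: deterministic_automaton_def S_def)
  obtain r p p' where run: "is_run E A W w e i M r" and pb: "is_pullback E r (Final M) p p'" and cl: "classifies E L p"
    using M(2) unfolding recognizes_def by blast
  obtain h where hom: "is_monoid_hom E W w e (Exp E S S) (endo_mult E S) (endo_unit E S) h"
    and r_def: "r = apply_exp E S S h (Start M \<cdot> bang E W)"
    using run unfolding is_run_def Let_def S_def by blast
  have h [simp]: "h \<in> Ar E" "Dom E h = W" "Cod E h = Exp E S S"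
    and h_w: "h \<cdot> w = endo_mult E S \<cdot> pair E (h \<cdot> Pr1 E W W) (h \<cdot> Pr2 E W W)"
    using hom unfolding is_monoid_hom_def by simp_all
  have r [simp]: "r \<in> Ar E" "Dom E r = W" "Cod E r = S"
    by (simp_all add: r_def)
  \<comment> \<open>Since multiplication of endomaps is in diagrammatic order, reading
    \<open>x y\<close> means reading \<open>y\<close> from the state reached by
    \<open>x\<close>.\<close>
  have r_w: "r \<cdot> (w \<cdot> pair E x y) = apply_exp E S S (h \<cdot> y) (r \<cdot> x)" if xy: "x \<in> hom E T W" "y \<in> hom E T W" for T x y
  proof -
    have T: "T \<in> Ob E" using xy by auto
    have "h \<cdot> (w \<cdot> pair E x y) = (h \<cdot> w) \<cdot> pair E x y"
      using xy by simp
    also have "\<dots> = endo_mult E S \<cdot> pair E (h \<cdot> x) (h \<cdot> y)"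
      unfolding h_w using xy by simp
    finally show ?thesis
      using xy T by (simp add: r_def)
  qed
  define \<chi> where "\<chi> = char (Final M)"
  have \<chi> [simp]: "\<chi> \<in> Ar E" "Dom E \<chi> = S" "Cod E \<chi> = Omega E"
    using F by (simp_all add: \<chi>_def)
  have L_eq: "L = \<chi> \<cdot> r"
  proof (rule Omega_ext[of _ W])
    note pD = pullbackD[OF pb]
    have pm: "monic E p" using pullback_monic[OF pb F(1)] .
    fix T b assume b: "b \<in> hom E T W"
    have "L \<cdot> b = true_at T \<longleftrightarrow> (\<exists>h \<in> hom E T (Dom E p). p \<cdot> h = b)"
      using classifies_iff[OF pm, of L] cl pD b by simp
    also have "\<dots> \<longleftrightarrow> (\<exists>h \<in> hom E T (Dom E (Final M)). Final M \<cdot> h = r \<cdot> b)"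
      using pullback_factor[OF pb, of b T] b by simp
    also have "\<dots> \<longleftrightarrow> (\<chi> \<cdot> r) \<cdot> b = true_at T"
      using char_iff[OF F(1), of "r \<cdot> b" T] b F by (simp add: \<chi>_def)
    finally show "L \<cdot> b = true_at T \<longleftrightarrow> (\<chi> \<cdot> r) \<cdot> b = true_at T" .
  qed simp_all
  let ?P = "Exp E W (Omega E)" and ?f = "transpose E W W (Omega E) (L \<cdot> w)"
  \<comment> \<open>\<open>g\<close> sends a state to the language accepted from it.\<close>
  define g where "g = transpose E S W (Omega E) (\<chi> \<cdot> apply_exp E S S (h \<cdot> Pr2 E S W) (Pr1 E S W))"
  have g [simp]: "g \<in> Ar E" "Dom E g = S" "Cod E g = ?P"
    by (simp_all add: g_def)
  have gr: "g \<cdot> r = ?f"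
  proof (rule Exp_ext_elements[of _ W W "Omega E"])
    fix T x y assume xy: "x \<in> hom E T W" "y \<in> hom E T W"
    have "apply_exp E W (Omega E) ((g \<cdot> r) \<cdot> x) y = \<chi> \<cdot> apply_exp E S S (h \<cdot> y) (r \<cdot> x)"
      using xy by (simp add: g_def)
    also have "\<dots> = L \<cdot> (w \<cdot> pair E x y)"
      using xy r_w[OF xy] by (simp add: L_eq)
    also have "\<dots> = apply_exp E W (Omega E) (?f \<cdot> x) y"
      using xy by simp
    finally show "apply_exp E W (Omega E) ((g \<cdot> r) \<cdot> x) y = apply_exp E W (Omega E) (?f \<cdot> x) y" .
  qed simp_all
  obtain s where s: "monic E s" "Dom E s = S" and C: "compact V E (Cod E s)"
    using sc unfolding sub_compact_def S_def by blast
  obtain g' where g': "g' \<in> hom E (Cod E s) ?P" "g' \<cdot> s = g"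
    by (rule Exp_Omega_injective[OF s(1), of g W]) (use s in simp_all)
  obtain m c where m: "monic E m" "Cod E m = ?P" and c: "cover c" "c \<in> hom E (Cod E s) (Dom E m)" "m \<cdot> c = g'"
    using image_factorization[OF g'(1)] by metis
  have f: "?f \<in> hom E W ?P" by simp
  \<comment> \<open>\<open>Q\<close> embeds into the image of \<open>?f\<close>, which is then
    placed inside the compact image of \<open>g'\<close>.\<close>
  obtain n d where n: "monic E n" "Cod E n = ?P" and d: "cover d" "d \<in> hom E W (Dom E n)" "n \<cdot> d = ?f"
    using image_factorization[OF f] by metis
  obtain k l q where kp: "is_kernel_pair E ?f k l" and co: "is_coequaliser E k l q" and Q: "Cod E q = Q"
    using mn unfolding is_myhill_nerode_quotient_def by blast
  obtain j where j: "monic E j" "j \<in> hom E Q (Dom E n)"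
    using kernel_pair_quotient_monic[OF f kp co d(1,2) n(1) d(3)] Q by metis
  have sD: "s \<in> Ar E" using s by simp
  have "m \<cdot> (c \<cdot> (s \<cdot> r)) = ((m \<cdot> c) \<cdot> s) \<cdot> r"
    using m(1) c(2) s sD by simp
  then have eq: "n \<cdot> d = m \<cdot> (c \<cdot> (s \<cdot> r))"
    by (simp only: c(3) g'(2) gr d(3))
  \<comment> \<open>\<open>?f\<close> factors through the image of \<open>g'\<close>, and
    orthogonality of the cover \<open>d\<close> to \<open>m\<close> turns this into an inclusion of
    images.\<close>
  obtain t where t: "t \<in> hom E (Dom E n) (Dom E m)" "m \<cdot> t = n"
    by (rule cover_orthogonal[OF d(1) m(1) _ _ eq]) (use n m d(2) c(2) s sD in simp_all)
  have "monic E t"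
    using monic_of_Comp[of m t] t m n by simp
  then have "monic E (t \<cdot> j)"
    using monic_Comp[OF j(1)] t(1) j(2) by simp
  moreover have "compact V E (Dom E m)"
    using compact_cover[OF _ c(1), of V] C c(2) by simp
  ultimately show ?thesis
    unfolding sub_compact_def using t(1) j(2) by (intro HOL.exI[of _ "t \<cdot> j"]) simp
qed

end

theorem mainTheorem9:
  fixes T :: "('s, 'f, 'r) pe_theory"
    and E :: "(('s, 'f, 'r, 'v) tobj, ('s, 'f, 'r, 'v) tarr) topos"
    and \<Sigma> W Q :: "('s, 'f, 'r, 'v) tobj"
    and concat empty letter L :: "('s, 'f, 'r, 'v) tarr"
  assumes "inaccessible TYPE('v)"
    and "positive_existential_theory T" and "small_theory TYPE('v) T"
    and "has_disjoint_coproducts (syntactic_category T)"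
    and "eliminates_imaginaries T"
    and "elementary_topos E" and "category.truncate E = classifying_topos T"
    and "is_free_monoid E \<Sigma> W concat empty letter"
    and "L \<in> hom E W (Omega E)"
    and "is_myhill_nerode_quotient E W concat L Q"
  shows "(\<exists>M. deterministic_automaton E \<Sigma> M \<and> sub_compact TYPE('v) E (States M) \<and>
              recognizes E \<Sigma> W concat empty letter M L)
         \<longleftrightarrow> sub_compact TYPE('v) E Q"
proof -
  interpret etopos E
    by (rule etopos.intro) (rule assms(6))
  show ?thesis
    using myhill_nerode_automaton[OF assms(8-10)] myhill_nerode_sub_compact[OF assms(8-10)] by metis
qed

end
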